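(* Let $n\ge1$, let $(W,S)$ be the Coxeter system of type $A_n$, let $\mathbb{F}$ be a field, and let $\mathbf{q}=(q_s\in\mathbb{F}:s\in S)$ be such that the Hecke algebra $\mathcal{H}(\mathbf{q})$ of $(W,S)$ with independent parameters $\mathbf{q}$ is collapse-free. Then $\dim_{\mathbb{F}}\mathcal{H}(\mathbf{q})\ge F_{n+2}$, and equality holds if and only if $\mathcal{H}(\mathbf{q})$ is commutative.
   Context: Type $A_n$: $S=\{s_1,\ldots,s_n\}$ with $m_{s_is_{i+1}}=3$ and $m_{s_is_j}=2$ for $|i-j|>1$. The Hecke algebra $\mathcal{H}(\mathbf{q})$ with independent parameters $\mathbf{q}$ is the unital associative $\mathbb{F}$-algebra generated by $\{T_s:s\in S\}$ subject to the quadratic relations $(T_s-1)(T_s+q_s)=0$ for all $s\in S$ and the braid relations $T_sT_tT_s=T_tT_sT_t$ if $m_{st}=3$ and $T_sT_t=T_tT_s$ if $m_{st}=2$. It is collapse-free if, whenever $m_{st}=3$ and $q_s\neq q_t$, at least one of $q_s$ and $q_t$ is $0$. Fibonacci numbers: $F_0=0$, $F_1=1$, $F_n=F_{n-1}+F_{n-2}$ for $n\geq2$. *)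

theory Defs
  imports
    "HOL-Algebra.Algebra"
    "HOL-Library.Poly_Mapping"
    "HOL-Library.Extended_Nat"
    "HOL-Number_Theory.Fib"
begin

text \<open>
  Words form the free monoid.  It is written additively, because the product of
  \<^theory>\<open>HOL-Library.Poly_Mapping\<close> is the convolution over an additive (here:
  noncommutative) monoid; thus finitely supported functions from words to a field are the
  noncommutative polynomials.
\<close>

datatype 's free_monoid = Word (letters: "'s list")

instantiation free_monoid :: (type) monoid_add
begin

definition zero_free_monoid :: "'a free_monoid"
  where "0 = Word []"

definition plus_free_monoid :: "'a free_monoid \<Rightarrow> 'a free_monoid \<Rightarrow> 'a free_monoid"
  where "u + v = Word (letters u @ letters v)"

instance
  by standard (simp_all add: zero_free_monoid_def plus_free_monoid_def)

end

type_synonym ('s, 'k) nc_poly = "'s free_monoid \<Rightarrow>\<^sub>0 'k"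

definition free_algebra :: "'s set \<Rightarrow> ('s, 'k::field) nc_poly ring"
  where "free_algebra S =
    \<lparr>carrier = {p. \<forall>w\<in>Poly_Mapping.keys p. set (letters w) \<subseteq> S},
     monoid.mult = (*), one = 1, ring.zero = 0, add = (+)\<rparr>"

definition scalar :: "'k::field \<Rightarrow> ('s, 'k) nc_poly"
  where "scalar c = Poly_Mapping.single 0 c"

definition gen :: "'s \<Rightarrow> ('s, 'k::field) nc_poly"
  where "gen s = Poly_Mapping.single (Word [s]) 1"

text \<open>
  The matrix \<open>m\<close> is meant to be a simply laced Coxeter matrix (off-diagonal entries 2 and 3),
  so that only two kinds of braid relations occur.  A relation \<open>a = b\<close> is represented by
  \<open>a - b\<close>.
\<close>

definition hecke_relations ::
    "'s set \<Rightarrow> ('s \<Rightarrow> 's \<Rightarrow> nat) \<Rightarrow> ('s \<Rightarrow> 'k::field) \<Rightarrow> ('s, 'k) nc_poly set"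
  where "hecke_relations S m q =
      {(gen s - 1) * (gen s + scalar (q s)) | s. s \<in> S}
    \<union> {gen s * gen t * gen s - gen t * gen s * gen t | s t. s \<in> S \<and> t \<in> S \<and> m s t = 3}
    \<union> {gen s * gen t - gen t * gen s | s t. s \<in> S \<and> t \<in> S \<and> m s t = 2}"

definition hecke_ideal ::
    "'s set \<Rightarrow> ('s \<Rightarrow> 's \<Rightarrow> nat) \<Rightarrow> ('s \<Rightarrow> 'k::field) \<Rightarrow> ('s, 'k) nc_poly set"
  where "hecke_ideal S m q = genideal (free_algebra S) (hecke_relations S m q)"

definition hecke_algebra ::
    "'s set \<Rightarrow> ('s \<Rightarrow> 's \<Rightarrow> nat) \<Rightarrow> ('s \<Rightarrow> 'k::field) \<Rightarrow> ('s, 'k) nc_poly set ring"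
  where "hecke_algebra S m q = free_algebra S Quot hecke_ideal S m q"

text \<open>
  The image of the ground field in the Hecke algebra.  It is a copy of the ground field, since
  the Hecke algebra is never zero: sending all generators to 1 respects the relations.
\<close>

definition hecke_scalars ::
    "'s set \<Rightarrow> ('s \<Rightarrow> 's \<Rightarrow> nat) \<Rightarrow> ('s \<Rightarrow> 'k::field) \<Rightarrow> ('s, 'k) nc_poly set set"
  where "hecke_scalars S m q =
    range (\<lambda>c. hecke_ideal S m q +>\<^bsub>free_algebra S\<^esub> scalar c)"

text \<open>Dimension of a ring as a vector space over a subfield.\<close>

definition algebra_dim :: "('a, 'b) ring_scheme \<Rightarrow> 'a set \<Rightarrow> enat"
  where "algebra_dim R K =
    (if \<exists>d. ring.dimension R d K (carrier R)
     then enat (THE d. ring.dimension R d K (carrier R)) else \<infinity>)"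

definition hecke_dim :: "'s set \<Rightarrow> ('s \<Rightarrow> 's \<Rightarrow> nat) \<Rightarrow> ('s \<Rightarrow> 'k::field) \<Rightarrow> enat"
  where "hecke_dim S m q = algebra_dim (hecke_algebra S m q) (hecke_scalars S m q)"

definition collapse_free :: "'s set \<Rightarrow> ('s \<Rightarrow> 's \<Rightarrow> nat) \<Rightarrow> ('s \<Rightarrow> 'k::field) \<Rightarrow> bool"
  where "collapse_free S m q \<longleftrightarrow>
    (\<forall>s\<in>S. \<forall>t\<in>S. m s t = 3 \<and> q s \<noteq> q t \<longrightarrow> q s = 0 \<or> q t = 0)"

text \<open>
  The Coxeter matrix of type A, where \<open>s\<^sub>i\<close> is represented by its index \<open>i\<close>; for rank \<open>n\<close> the
  index set is \<open>{1..n}\<close>.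
\<close>

definition coxeter_A :: "nat \<Rightarrow> nat \<Rightarrow> nat"
  where "coxeter_A i j = (if i = j then 1 else if j = i + 1 \<or> i = j + 1 then 3 else 2)"

end

theory Submission
  imports Defs
begin

text \<open>
  Lower bound: fix a set \<open>S\<close> of positions with parameter 0.  Let \<open>T\<^sub>i\<close> act on words as the scalar 1 or 0
  if \<open>q\<^sub>i = 0\<close>, according to \<open>i \<in> S\<close>; as 1 if \<open>q\<^sub>i \<noteq> 0\<close> and the block of nonzero parameters around \<open>i\<close>
  borders on an element of \<open>S\<close>; and as the usual Hecke operator exchanging the letters \<open>i\<close> and \<open>i + 1\<close>
  otherwise.  In the sum of these modules over all \<open>S\<close>, the products of \<open>T\<^sub>i\<close> and \<open>1 - T\<^sub>i\<close> over the
  positions with parameter 0 separate the summands, so many basis vectors \<open>(S, x)\<close> lie in the orbit of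
  a single vector.  Their number is at least \<open>F\<^sub>n\<^sub>+\<^sub>2\<close>, and larger as soon as two adjacent parameters agree.

  If no adjacent parameters agree, then exactly one of them is 0 for each adjacent pair, and
  \<open>T\<^sub>s T\<^sub>t = T\<^sub>t T\<^sub>s = T\<^sub>s\<close> if \<open>q\<^sub>s = 0 \<noteq> q\<^sub>t\<close>.  Hence the algebra is commutative and spanned by the \<open>F\<^sub>n\<^sub>+\<^sub>2\<close>
  products of pairwise nonadjacent generators.  If two adjacent parameters agree, the Hecke operators
  on words show that the two generators do not commute.
\<close>

section \<open>The free algebra\<close>

lemma free_algebra_simps [simp]:
  "monoid.mult (free_algebra S) = (*)" "one (free_algebra S) = 1"
  "ring.zero (free_algebra S) = 0" "add (free_algebra S) = (+)"
  by (simp_all add: free_algebra_def)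

lemma carrier_free_algebra:
  "p \<in> carrier (free_algebra S) \<longleftrightarrow> (\<forall>w\<in>Poly_Mapping.keys p. set (letters w) \<subseteq> S)"
  by (simp add: free_algebra_def)

lemma free_algebra_zero_closed [simp, intro]: "0 \<in> carrier (free_algebra S)"
  by (simp add: carrier_free_algebra)

lemma free_algebra_scalar_closed [simp, intro]: "scalar c \<in> carrier (free_algebra S)"
  by (simp add: carrier_free_algebra scalar_def zero_free_monoid_def)

lemma scalar_simps:
  "scalar 0 = 0" "scalar 1 = 1" "scalar (a + b) = scalar a + scalar b"
  "scalar (a - b) = scalar a - scalar b"
  "scalar (a * b) = scalar a * scalar b" "scalar (- a) = - scalar a"
  by (simp_all add: scalar_def single_add single_diff mult_single single_uminus)

lemma free_algebra_one_closed [simp, intro]: "1 \<in> carrier (free_algebra S)"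
  using free_algebra_scalar_closed[of 1] by (simp add: scalar_simps)

lemma free_algebra_gen_closed [simp, intro]: "s \<in> S \<Longrightarrow> gen s \<in> carrier (free_algebra S)"
  by (simp add: carrier_free_algebra gen_def)

lemma free_algebra_add_closed [simp, intro]:
  "p \<in> carrier (free_algebra S) \<Longrightarrow> q \<in> carrier (free_algebra S) \<Longrightarrow> p + q \<in> carrier (free_algebra S)"
  using keys_add[of p q] by (auto simp: carrier_free_algebra)

lemma free_algebra_uminus_closed [simp, intro]:
  "p \<in> carrier (free_algebra S) \<Longrightarrow> - p \<in> carrier (free_algebra S)"
  by (simp add: carrier_free_algebra)

lemma free_algebra_minus_closed [simp, intro]:
  "p \<in> carrier (free_algebra S) \<Longrightarrow> q \<in> carrier (free_algebra S) \<Longrightarrow> p - q \<in> carrier (free_algebra S)"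
  using keys_diff[of p q] by (auto simp: carrier_free_algebra)

lemma free_algebra_mult_closed [simp, intro]:
  assumes "p \<in> carrier (free_algebra S)" "q \<in> carrier (free_algebra S)"
  shows "p * q \<in> carrier (free_algebra S)"
proof -
  have "set (letters (a + b)) \<subseteq> S" if "a \<in> Poly_Mapping.keys p" "b \<in> Poly_Mapping.keys q" for a b
    using assms that by (auto simp: carrier_free_algebra plus_free_monoid_def)
  then show ?thesis
    using keys_mult[of p q] unfolding carrier_free_algebra by blast
qed

lemma ring_free_algebra: "ring (free_algebra S)"
proof (rule ringI)
  show "abelian_group (free_algebra S)"
  proof (rule abelian_groupI)
    fix p assume "p \<in> carrier (free_algebra S)"
    then show "\<exists>r\<in>carrier (free_algebra S). r \<oplus>\<^bsub>free_algebra S\<^esub> p = \<zero>\<^bsub>free_algebra S\<^esub>"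
      by (intro bexI[of _ "- p"]) auto
  qed (auto simp: add_ac)
  show "monoid (free_algebra S)"
    by (rule monoidI) (auto simp: mult.assoc)
qed (auto simp: distrib_left distrib_right)

lemma a_inv_free_algebra:
  assumes "p \<in> carrier (free_algebra S)"
  shows "\<ominus>\<^bsub>free_algebra S\<^esub> p = - p"
proof -
  interpret ring "free_algebra S" by (rule ring_free_algebra)
  show ?thesis
    using assms by (intro minus_equality) auto
qed

lemma a_minus_free_algebra:
  assumes "q \<in> carrier (free_algebra S)"
  shows "p \<ominus>\<^bsub>free_algebra S\<^esub> q = p - q"
  using assms by (simp add: a_minus_def a_inv_free_algebra)

lemma scalar_mult_single: "scalar c * Poly_Mapping.single w d = Poly_Mapping.single w (c * d)"
  by (simp add: scalar_def mult_single)

lemma poly_mapping_sum_single: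
  fixes p :: "'a \<Rightarrow>\<^sub>0 'b::comm_monoid_add"
  shows "p = (\<Sum>w\<in>Poly_Mapping.keys p. Poly_Mapping.single w (Poly_Mapping.lookup p w))"
  by (rule poly_mapping_eqI)
     (auto simp: lookup_sum lookup_single when_def in_keys_iff sum.delta' cong: if_cong)

text \<open>The alternative \<open>c = 0\<close> supplies the zero polynomial, the value of the
  empty sum in the base case.\<close>

lemma poly_mapping_add_induct [case_names single add]:
  fixes p :: "'a \<Rightarrow>\<^sub>0 'b::comm_monoid_add"
  assumes single: "\<And>w c. w \<in> Poly_Mapping.keys p \<or> c = 0 \<Longrightarrow> P (Poly_Mapping.single w c)"
    and add: "\<And>a b. P a \<Longrightarrow> P b \<Longrightarrow> P (a + b)"
  shows "P p"
proof -
  have "P (\<Sum>w\<in>A. Poly_Mapping.single w (Poly_Mapping.lookup p w))"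
    if "finite A" "A \<subseteq> Poly_Mapping.keys p" for A
    using that
  proof (induction A rule: finite_induct)
    case empty
    show ?case using single[of undefined 0] by simp
  qed (simp add: add single)
  then have "P (\<Sum>w\<in>Poly_Mapping.keys p. Poly_Mapping.single w (Poly_Mapping.lookup p w))"
    by simp
  then show ?thesis
    using poly_mapping_sum_single[of p] by simp
qed

text \<open>Words are products of generators, and polynomials are sums of scaled words. The inner
  claim on words carries membership in the carrier along, because the product case asks for
  it.\<close>

lemma free_algebra_induct [consumes 1, case_names scalar gen add mult]:
  fixes p :: "('s, 'k::field) nc_poly"
  assumes p: "p \<in> carrier (free_algebra S)"
    and scalar: "\<And>c. P (scalar c)"
    and gen: "\<And>s. s \<in> S \<Longrightarrow> P (gen s)"
    and add: "\<And>a b. a \<in> carrier (free_algebra S) \<Longrightarrow> b \<in> carrier (free_algebra S) \<Longrightarrow>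
                P a \<Longrightarrow> P b \<Longrightarrow> P (a + b)"
    and mult: "\<And>a b. a \<in> carrier (free_algebra S) \<Longrightarrow> b \<in> carrier (free_algebra S) \<Longrightarrow>
                P a \<Longrightarrow> P b \<Longrightarrow> P (a * b)"
  shows "P p"
proof -
  have word: "Poly_Mapping.single (Word u) (1::'k) \<in> carrier (free_algebra S)
      \<and> P (Poly_Mapping.single (Word u) 1)"
    if "set u \<subseteq> S" for u
    using that
  proof (induction u)
    case Nil
    show ?case
      using scalar[of 1] by (auto simp: scalar_def zero_free_monoid_def carrier_free_algebra)
  next
    case (Cons s u)
    have eq: "Poly_Mapping.single (Word (s # u)) (1::'k) = gen s * Poly_Mapping.single (Word u) 1"
      by (simp add: gen_def mult_single plus_free_monoid_def)
    have "Poly_Mapping.single (Word u) (1::'k) \<in> carrier (free_algebra S)" "P (Poly_Mapping.single (Word u) 1)" "s \<in> S"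
      using Cons by simp_all
    then show ?case
      unfolding eq using mult[OF _ _ gen] by simp
  qed
  have "p \<in> carrier (free_algebra S) \<and> P p"
  proof (induction p rule: poly_mapping_add_induct)
    case (single w c)
    show ?case
    proof (cases "c = 0")
      case True
      then show ?thesis using scalar[of 0] by (simp add: scalar_simps)
    next
      case False
      then have w: "set (letters w) \<subseteq> S"
        using single p by (auto simp: carrier_free_algebra)
      have eq: "Poly_Mapping.single w c = scalar c * Poly_Mapping.single (Word (letters w)) 1"
        by (simp add: scalar_mult_single)
      show ?thesis
        unfolding eq using word[OF w] by (auto intro!: mult scalar)
    qed
  qed (auto intro: add)
  then show ?thesis ..
qed

lemma scalar_commute: "scalar c * p = p * scalar c"
  by (induction p rule: poly_mapping_add_induct)
     (simp_all add: scalar_def mult_single distrib_left distrib_right mult.commute)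

section \<open>Linear actions of the free algebra\<close>

text \<open>Each letter \<open>s\<close> acts by \<open>T s\<close>. Since \<open>foldr\<close>
  applies the last letter first, a product acts as the composition of its factors in the same
  order.\<close>

definition act ::
    "('s \<Rightarrow> ('x \<Rightarrow> 'k) \<Rightarrow> 'x \<Rightarrow> 'k) \<Rightarrow> ('s, 'k::field) nc_poly \<Rightarrow> ('x \<Rightarrow> 'k) \<Rightarrow> 'x \<Rightarrow> 'k"
  where "act T p f x = (\<Sum>w\<in>Poly_Mapping.keys p. Poly_Mapping.lookup p w * foldr T (letters w) f x)"

lemma act_superset:
  assumes "finite A" "Poly_Mapping.keys p \<subseteq> A"
  shows "act T p f x = (\<Sum>w\<in>A. Poly_Mapping.lookup p w * foldr T (letters w) f x)"
  unfolding act_def using assms by (intro sum.mono_neutral_left) (auto simp: in_keys_iff)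

lemma act_add: "act T (p + q) f x = act T p f x + act T q f x"
proof -
  let ?A = "Poly_Mapping.keys p \<union> Poly_Mapping.keys q"
  show ?thesis
    using keys_add[of p q]
    by (simp add: act_superset[of ?A] lookup_add distrib_right sum.distrib)
qed

lemma act_single: "act T (Poly_Mapping.single w c) f x = c * foldr T (letters w) f x"
  by (simp add: act_def)

lemma act_scalar: "act T (scalar c) f x = c * f x"
  by (simp add: scalar_def act_single zero_free_monoid_def)

lemma act_zero: "act T 0 f x = 0"
  by (simp add: act_def)

lemma act_one: "act T 1 f = f"
  using act_scalar[of T 1 f] by (simp add: scalar_simps fun_eq_iff)

lemma act_gen: "act T (gen s) f = T s f"
  by (simp add: gen_def act_single fun_eq_iff)

lemma act_uminus: "act T (- p) f x = - act T p f x"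
  using act_add[of T p "- p" f x] by (simp add: act_zero eq_neg_iff_add_eq_0 add.commute)

lemma act_diff: "act T (p - q) f x = act T p f x - act T q f x"
  using act_add[of T p "- q" f x] by (simp add: act_uminus)

locale linear_action =
  fixes T :: "'s \<Rightarrow> ('x \<Rightarrow> 'k::field) \<Rightarrow> 'x \<Rightarrow> 'k"
  assumes T_add: "T s (\<lambda>x. f x + g x) = (\<lambda>x. T s f x + T s g x)"
    and T_scale: "T s (\<lambda>x. c * f x) = (\<lambda>x. c * T s f x)"
begin

lemma foldr_add: "foldr T u (\<lambda>x. f x + g x) = (\<lambda>x. foldr T u f x + foldr T u g x)"
  by (induction u) (simp_all add: T_add)

lemma foldr_scale: "foldr T u (\<lambda>x. c * f x) = (\<lambda>x. c * foldr T u f x)"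
  by (induction u) (simp_all add: T_scale)

lemma foldr_zero: "foldr T u (\<lambda>x. 0) = (\<lambda>x. 0)"
  using foldr_scale[of u 0 "\<lambda>x. 0"] by simp

lemma act_on_zero: "act T p (\<lambda>x. 0) = (\<lambda>x. 0)"
  by (simp add: act_def foldr_zero fun_eq_iff)

lemma act_mult: "act T (p * q) f = act T p (act T q f)"
proof (induction p rule: poly_mapping_add_induct)
  case (single a c)
  show ?case
  proof (induction q rule: poly_mapping_add_induct)
    case (single b d)
    have "act T (Poly_Mapping.single b d) f = (\<lambda>x. d * foldr T (letters b) f x)"
      by (simp add: act_single fun_eq_iff)
    then show ?case
      by (simp add: mult_single fun_eq_iff act_single plus_free_monoid_def foldr_scale mult.assoc)
  next
    case (add p q)
    have "act T (p + q) f = (\<lambda>x. act T p f x + act T q f x)"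
      by (simp add: act_add fun_eq_iff)
    then show ?case
      by (simp add: add distrib_left fun_eq_iff act_add act_single foldr_add)
  qed
next
  case (add a b)
  then show ?case
    by (simp add: distrib_right act_add fun_eq_iff)
qed

end

section \<open>Hecke algebras as quotients of the free algebra\<close>

definition hecke_class ::
    "'s set \<Rightarrow> ('s \<Rightarrow> 's \<Rightarrow> nat) \<Rightarrow> ('s \<Rightarrow> 'k::field) \<Rightarrow> ('s, 'k) nc_poly \<Rightarrow> ('s, 'k) nc_poly set"
  where "hecke_class S m q p = hecke_ideal S m q +>\<^bsub>free_algebra S\<^esub> p"

lemma hecke_relations_closed: "hecke_relations S m q \<subseteq> carrier (free_algebra S)"
  by (auto simp: hecke_relations_def)

lemma ideal_hecke_ideal: "ideal (hecke_ideal S m q) (free_algebra S)"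
  unfolding hecke_ideal_def
  by (intro ring.genideal_ideal ring_free_algebra hecke_relations_closed)

lemma hecke_relations_in_ideal: "r \<in> hecke_relations S m q \<Longrightarrow> r \<in> hecke_ideal S m q"
  unfolding hecke_ideal_def
  using ring.genideal_self[OF ring_free_algebra hecke_relations_closed] by blast

lemma hecke_ideal_add:
  "a \<in> hecke_ideal S m q \<Longrightarrow> b \<in> hecke_ideal S m q \<Longrightarrow> a + b \<in> hecke_ideal S m q"
  using additive_subgroup.a_closed[OF ideal.axioms(1)[OF ideal_hecke_ideal]] by fastforce

lemma hecke_ideal_closed: "a \<in> hecke_ideal S m q \<Longrightarrow> a \<in> carrier (free_algebra S)"
  using additive_subgroup.a_Hcarr[OF ideal.axioms(1)[OF ideal_hecke_ideal]] by fastforce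

lemma hecke_ideal_lmult:
  "a \<in> hecke_ideal S m q \<Longrightarrow> p \<in> carrier (free_algebra S) \<Longrightarrow> p * a \<in> hecke_ideal S m q"
  using ideal.I_l_closed[OF ideal_hecke_ideal] by fastforce

lemma hecke_ideal_rmult:
  "a \<in> hecke_ideal S m q \<Longrightarrow> p \<in> carrier (free_algebra S) \<Longrightarrow> a * p \<in> hecke_ideal S m q"
  using ideal.I_r_closed[OF ideal_hecke_ideal] by fastforce

lemma hecke_ideal_uminus: "a \<in> hecke_ideal S m q \<Longrightarrow> - a \<in> hecke_ideal S m q"
  using hecke_ideal_lmult[of a S m q "- 1"] by simp

lemma hecke_ideal_diff:
  "a \<in> hecke_ideal S m q \<Longrightarrow> b \<in> hecke_ideal S m q \<Longrightarrow> a - b \<in> hecke_ideal S m q"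
  using hecke_ideal_add[of a S m q "- b"] hecke_ideal_uminus[of b S m q] by simp

lemma hecke_class_eq_iff:
  assumes "a \<in> carrier (free_algebra S)" "b \<in> carrier (free_algebra S)"
  shows "hecke_class S m q a = hecke_class S m q b \<longleftrightarrow> a - b \<in> hecke_ideal S m q"
  using ring.quotient_eq_iff_same_a_r_cos[OF ring_free_algebra ideal_hecke_ideal assms]
  by (simp add: hecke_class_def a_minus_free_algebra assms)

lemma hecke_class_hom:
  "ring_hom_ring (free_algebra S) (hecke_algebra S m q) (hecke_class S m q)"
  unfolding hecke_algebra_def hecke_class_def
  by (rule ideal.rcos_ring_hom_ring[OF ideal_hecke_ideal])

lemma ring_hecke_algebra: "ring (hecke_algebra S m q)"
  unfolding hecke_algebra_def by (rule ideal.quotient_is_ring[OF ideal_hecke_ideal])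

lemma carrier_hecke_algebra:
  "carrier (hecke_algebra S m q) = hecke_class S m q ` carrier (free_algebra S)"
  by (auto simp: hecke_algebra_def FactRing_def A_RCOSETS_def' hecke_class_def)

lemma hecke_class_add:
  assumes "a \<in> carrier (free_algebra S)" "b \<in> carrier (free_algebra S)"
  shows "hecke_class S m q a \<oplus>\<^bsub>hecke_algebra S m q\<^esub> hecke_class S m q b = hecke_class S m q (a + b)"
  using ring_hom_add[OF ring_hom_ring.homh[OF hecke_class_hom] assms] by simp

lemma hecke_class_mult:
  assumes "a \<in> carrier (free_algebra S)" "b \<in> carrier (free_algebra S)"
  shows "hecke_class S m q a \<otimes>\<^bsub>hecke_algebra S m q\<^esub> hecke_class S m q b = hecke_class S m q (a * b)"
  using ring_hom_mult[OF ring_hom_ring.homh[OF hecke_class_hom] assms] by simp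

lemma hecke_class_one: "\<one>\<^bsub>hecke_algebra S m q\<^esub> = hecke_class S m q 1"
  using ring_hom_one[OF ring_hom_ring.homh[OF hecke_class_hom], of S m q] by simp

lemma hecke_class_zero: "\<zero>\<^bsub>hecke_algebra S m q\<^esub> = hecke_class S m q 0"
  using ring_hom_zero[OF ring_hom_ring.homh[OF hecke_class_hom, of S m q] ring_free_algebra ring_hecke_algebra]
  by simp

lemma hecke_scalars_eq: "hecke_scalars S m q = hecke_class S m q ` range scalar"
  by (auto simp: hecke_scalars_def hecke_class_def)

section \<open>Modules over the Hecke algebra\<close>

locale hecke_action = linear_action T
  for T :: "'s \<Rightarrow> ('x \<Rightarrow> 'k::field) \<Rightarrow> 'x \<Rightarrow> 'k" +
  fixes S :: "'s set" and m :: "'s \<Rightarrow> 's \<Rightarrow> nat" and q :: "'s \<Rightarrow> 'k"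
  assumes quadratic: "s \<in> S \<Longrightarrow> T s (T s f) x = (1 - q s) * T s f x + q s * f x"
    and braid3: "s \<in> S \<Longrightarrow> t \<in> S \<Longrightarrow> m s t = 3 \<Longrightarrow> T s (T t (T s f)) = T t (T s (T t f))"
    and braid2: "s \<in> S \<Longrightarrow> t \<in> S \<Longrightarrow> m s t = 2 \<Longrightarrow> T s (T t f) = T t (T s f)"
begin

lemma act_relation: "r \<in> hecke_relations S m q \<Longrightarrow> act T r f = (\<lambda>x. 0)"
  unfolding hecke_relations_def
proof (elim UnE CollectE exE conjE)
  fix s assume r: "r = (gen s - 1) * (gen s + scalar (q s))" and s: "s \<in> S"
  have "act T (gen s + scalar (q s)) f = (\<lambda>x. T s f x + q s * f x)"
    by (intro ext) (simp add: act_add act_gen act_scalar)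
  moreover have "T s (\<lambda>x. T s f x + q s * f x) = (\<lambda>x. T s (T s f) x + q s * T s f x)"
    by (simp add: T_add T_scale)
  ultimately show ?thesis
    unfolding r act_mult by (intro ext) (simp add: act_diff act_gen act_one quadratic[OF s] algebra_simps)
next
  fix s t assume "r = gen s * gen t * gen s - gen t * gen s * gen t" "s \<in> S" "t \<in> S" "m s t = 3"
  then show ?thesis
    using braid3[of s t f] by (intro ext) (simp add: act_mult act_diff act_gen)
next
  fix s t assume "r = gen s * gen t - gen t * gen s" "s \<in> S" "t \<in> S" "m s t = 2"
  then show ?thesis
    using braid2[of s t f] by (intro ext) (simp add: act_mult act_diff act_gen)
qed

text \<open>The polynomials annihilating every function form a two-sided ideal that contains the
  relations, hence the whole Hecke ideal. Quantifying over all \<open>f\<close> is what gives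
  closure under multiplication from the right.\<close>

lemma act_hecke_ideal:
  assumes "p \<in> hecke_ideal S m q"
  shows "act T p f = (\<lambda>x. 0)"
proof -
  let ?F = "free_algebra S"
  let ?J = "{p \<in> carrier ?F. \<forall>f. act T p f = (\<lambda>x. 0)}"
  interpret F: ring ?F by (rule ring_free_algebra)
  have "ideal ?J ?F"
  proof (rule idealI[OF ring_free_algebra])
    show "subgroup ?J (add_monoid ?F)"
      by (rule F.add.subgroupI)
         (auto simp: act_zero act_add act_uminus a_inv_free_algebra fun_eq_iff simp flip: a_inv_def
           intro!: exI[of _ 0])
  qed (auto simp: act_mult act_on_zero)
  then have "hecke_ideal S m q \<subseteq> ?J"
    unfolding hecke_ideal_def
    using act_relation hecke_relations_closed by (intro F.genideal_minimal) blast+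
  then show ?thesis using assms by blast
qed

end

text \<open>The one-dimensional module on which all generators act as the identity satisfies the
  relations, and 1 does not act as 0 on it.\<close>

lemma one_not_in_hecke_ideal: "1 \<notin> hecke_ideal S m q"
proof
  assume *: "1 \<in> hecke_ideal S m q"
  interpret hecke_action "\<lambda>s f. f :: unit \<Rightarrow> 'b" S m q
    by unfold_locales (auto simp: algebra_simps)
  show False
    using act_hecke_ideal[OF *, of "\<lambda>x. 1"] by (simp add: act_one fun_eq_iff)
qed

lemma subfield_scalars:
  fixes S :: "'s set"
  shows "subfield (range scalar) (free_algebra S :: ('s, 'k::field) nc_poly ring)"
proof -
  let ?F = "free_algebra S :: ('s, 'k) nc_poly ring"
  interpret F: ring ?F by (rule ring_free_algebra)
  have sub: "subring (range scalar) ?F"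
  proof (rule F.subringI)
    show "\<one>\<^bsub>?F\<^esub> \<in> range scalar"
      by (rule range_eqI[of _ _ 1]) (simp add: scalar_simps)
  next
    fix h :: "('s, 'k) nc_poly" assume "h \<in> range scalar"
    then obtain c where "h = scalar c" by blast
    then show "\<ominus>\<^bsub>?F\<^esub> h \<in> range scalar"
      by (intro range_eqI[of _ _ "- c"]) (simp add: scalar_simps a_inv_free_algebra)
  next
    fix h k :: "('s, 'k) nc_poly" assume "h \<in> range scalar" "k \<in> range scalar"
    then obtain c d where "h = scalar c" "k = scalar d" by blast
    then show "h \<otimes>\<^bsub>?F\<^esub> k \<in> range scalar" "h \<oplus>\<^bsub>?F\<^esub> k \<in> range scalar"
      by (auto simp flip: scalar_simps(3,5))
  qed auto
  have "subcring (range scalar) ?F"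
    by (rule F.subcringI[OF sub]) (auto intro: scalar_commute)
  moreover have "Units (?F\<lparr>carrier := range scalar\<rparr>) = range scalar - {0}"
  proof (intro equalityI subsetI)
    fix x :: "('s, 'k) nc_poly" assume "x \<in> Units (?F\<lparr>carrier := range scalar\<rparr>)"
    then show "x \<in> range scalar - {0}"
      by (auto simp: Units_def)
  next
    fix x :: "('s, 'k) nc_poly" assume "x \<in> range scalar - {0}"
    then obtain c where x: "x = scalar c" and c: "c \<noteq> 0"
      by (metis DiffE image_iff scalar_simps(1) singletonI)
    have "scalar c * scalar (inverse c) = (1 :: ('s, 'k) nc_poly)"
      "scalar (inverse c) * scalar c = (1 :: ('s, 'k) nc_poly)"
      using c by (simp_all only: scalar_simps(5)[symmetric] right_inverse left_inverse scalar_simps(2)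
          not_False_eq_True)
    then show "x \<in> Units (?F\<lparr>carrier := range scalar\<rparr>)"
      by (auto simp: Units_def x)
  qed
  ultimately show ?thesis
    by (intro F.subfieldI) simp_all
qed

text \<open>The image of a field under a ring homomorphism is again a field as soon as the target is
  not the zero ring.\<close>

lemma subfield_hecke_scalars: "subfield (hecke_scalars S m q) (hecke_algebra S m q)"
  unfolding hecke_scalars_eq
proof (rule ring_hom_ring.img_is_subfield(2)[OF hecke_class_hom subfield_scalars])
  show "\<one>\<^bsub>hecke_algebra S m q\<^esub> \<noteq> \<zero>\<^bsub>hecke_algebra S m q\<^esub>"
    using one_not_in_hecke_ideal[of S m q]
    by (simp add: hecke_class_one hecke_class_zero hecke_class_eq_iff)
qed

section \<open>Bounding the dimension by spanning lists and by orbits\<close>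

lemma hecke_dim_eq:
  assumes "ring.dimension (hecke_algebra S m q) d (hecke_scalars S m q) (carrier (hecke_algebra S m q))"
  shows "hecke_dim S m q = enat d"
proof -
  interpret H: ring "hecke_algebra S m q" by (rule ring_hecke_algebra)
  have "(THE d. H.dimension d (hecke_scalars S m q) (carrier (hecke_algebra S m q))) = d"
    using assms H.dimension_is_inj[OF subfield_hecke_scalars] by blast
  then show ?thesis
    using assms unfolding hecke_dim_def algebra_dim_def by auto
qed

text \<open>Working from the end of the list, a vector is kept only if it lies outside the span of
  those after it.\<close>

lemma (in ring) independent_sublist_of_spanning:
  assumes K: "subfield K R" and "set Us \<subseteq> carrier R"
  shows "\<exists>Vs. independent K Vs \<and> Span K Vs = Span K Us \<and> length Vs \<le> length Us"
  using assms(2)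
proof (induction Us)
  case Nil
  show ?case by (rule exI[of _ "[]"]) simp
next
  case (Cons u Us)
  then obtain Vs where Vs: "independent K Vs" "Span K Vs = Span K Us" "length Vs \<le> length Us"
    by auto
  show ?case
  proof (cases "u \<in> Span K Us")
    case True
    then have "Span K (u # Us) \<subseteq> Span K Us"
      using Cons.prems Span_base_incl[OF K, of Us] by (intro mono_Span_subset[OF K]) auto
    then have "Span K (u # Us) = Span K Us"
      using mono_Span[OF K, of Us u] Cons.prems by auto
    then show ?thesis
      using Vs by (intro exI[of _ Vs]) simp
  next
    case False
    then have "independent K (u # Vs)"
      using Vs Cons.prems by (intro li_Cons) auto
    then show ?thesis
      using Vs by (intro exI[of _ "u # Vs"]) simp
  qed
qed

lemma hecke_dim_le:
  assumes Us: "set Us \<subseteq> carrier (hecke_algebra S m q)"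
    and span: "carrier (hecke_algebra S m q)
      \<subseteq> ring.Span (hecke_algebra S m q) (hecke_scalars S m q) Us"
  shows "hecke_dim S m q \<le> enat (length Us)"
proof -
  let ?K = "hecke_scalars S m q"
  interpret H: ring "hecke_algebra S m q" by (rule ring_hecke_algebra)
  note K = subfield_hecke_scalars[of S m q]
  obtain Vs where Vs: "H.independent ?K Vs" "H.Span ?K Vs = H.Span ?K Us" "length Vs \<le> length Us"
    using H.independent_sublist_of_spanning[OF K Us] by metis
  have "H.Span ?K Vs = carrier (hecke_algebra S m q)"
    using Vs span H.Span_subgroup_props(1)[OF K Us] by auto
  then have dim: "H.dimension (length Vs) ?K (carrier (hecke_algebra S m q))"
    using H.dimension_independent[OF Vs(1)] by metis
  then show ?thesis
    using hecke_dim_eq[OF dim] Vs(3) by simp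
qed

context hecke_action
begin

text \<open>If elements \<open>h x\<close> of the algebra carry one vector \<open>v\<close> to
  distinct point functions, their classes are linearly independent. Without a finite dimension,
  \<open>hecke_dim\<close> is infinite by definition.\<close>

lemma hecke_dim_ge:
  assumes A: "finite A"
    and reach: "\<And>x. x \<in> A \<Longrightarrow> \<exists>p\<in>carrier (free_algebra S). act T p v = (\<lambda>y. of_bool (y = x))"
  shows "enat (card A) \<le> hecke_dim S m q"
proof (cases "\<exists>d. ring.dimension (hecke_algebra S m q) d (hecke_scalars S m q)
                    (carrier (hecke_algebra S m q))")
  case False
  then show ?thesis by (simp add: hecke_dim_def algebra_dim_def)
next
  case True
  interpret H: ring "hecke_algebra S m q" by (rule ring_hecke_algebra)
  let ?K = "hecke_scalars S m q" and ?c = "hecke_class S m q"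
  from True obtain d where d: "H.dimension d ?K (carrier (hecke_algebra S m q))"
    by blast
  from reach obtain h where h: "\<And>x. x \<in> A \<Longrightarrow> h x \<in> carrier (free_algebra S)"
    and hv: "\<And>x. x \<in> A \<Longrightarrow> act T (h x) v = (\<lambda>y. of_bool (y = x))"
    by metis
  \<comment> \<open>Cosets do not act themselves, so the span is controlled through representatives:
    a combination of the classes of \<open>h y\<close> with \<open>y \<noteq> x\<close> has one
    whose action on \<open>v\<close> vanishes at \<open>x\<close>.\<close>
  have vanish: "\<exists>p\<in>carrier (free_algebra S). a = ?c p \<and> act T p v x = 0"
    if "a \<in> H.Span ?K (map (\<lambda>y. ?c (h y)) ys)" "x \<notin> set ys" "set ys \<subseteq> A" for a x ys
    using that
  proof (induction ys arbitrary: a)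
    case Nil
    then show ?case
      by (intro bexI[of _ 0]) (auto simp: hecke_class_zero act_zero)
  next
    case (Cons y ys)
    from Cons.prems(1) obtain c w where a: "a = ?c (scalar c) \<otimes>\<^bsub>hecke_algebra S m q\<^esub> ?c (h y) \<oplus>\<^bsub>hecke_algebra S m q\<^esub> w"
      and w: "w \<in> H.Span ?K (map (\<lambda>y. ?c (h y)) ys)"
      by (auto simp: H.line_extension_mem_iff hecke_scalars_eq)
    from Cons.IH[OF w] Cons.prems obtain p where p: "p \<in> carrier (free_algebra S)" "w = ?c p"
      "act T p v x = 0" by auto
    have y: "y \<in> A" using Cons.prems by simp
    have "a = ?c (scalar c * h y + p)"
      using p h[OF y] by (simp add: a hecke_class_mult hecke_class_add)
    moreover have "act T (scalar c * h y + p) v x = 0"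
      using p Cons.prems by (simp add: act_add act_mult act_scalar hv[OF y])
    ultimately show ?case
      using p h[OF y] by (intro bexI[of _ "scalar c * h y + p"]) auto
  qed
  have indep: "H.independent ?K (map (\<lambda>y. ?c (h y)) ys)" if "distinct ys" "set ys \<subseteq> A" for ys
    using that
  proof (induction ys)
    case (Cons y ys)
    have "?c (h y) \<notin> H.Span ?K (map (\<lambda>y. ?c (h y)) ys)"
    proof
      assume "?c (h y) \<in> H.Span ?K (map (\<lambda>y. ?c (h y)) ys)"
      from vanish[OF this, of y] Cons.prems obtain p where p: "p \<in> carrier (free_algebra S)"
        "?c (h y) = ?c p" "act T p v y = 0" by auto
      \<comment> \<open>The ideal annihilates \<open>v\<close>, whereas at \<open>y\<close> the
        element \<open>h y\<close> gives the value 1 and \<open>p\<close> gives 0.\<close>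
      then have "h y - p \<in> hecke_ideal S m q"
        using Cons.prems h[of y] by (simp add: hecke_class_eq_iff)
      from fun_cong[OF act_hecke_ideal[OF this, of v], of y] show False
        using p Cons.prems by (simp add: act_diff hv)
    qed
    then show ?case
      using Cons h[of y] by (auto simp: carrier_hecke_algebra intro!: H.li_Cons)
  qed simp
  from A obtain ys where ys: "set ys = A" "distinct ys"
    using finite_distinct_list by blast
  have "length (map (\<lambda>y. ?c (h y)) ys) \<le> d"
    using ys h by (intro H.independent_length_le_dimension[OF subfield_hecke_scalars d indep])
      (auto simp: carrier_hecke_algebra)
  then show ?thesis
    using hecke_dim_eq[OF d] ys distinct_card[of ys] by simp
qed

end

section \<open>Hecke operators on words\<close>

definition swap_letters :: "nat \<Rightarrow> (nat \<Rightarrow> nat) \<Rightarrow> nat \<Rightarrow> nat"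
  where "swap_letters i y = y(i := y (Suc i), Suc i := y i)"

lemma swap_letters_apply:
  "swap_letters i y k = (if k = i then y (Suc i) else if k = Suc i then y i else y k)"
  by (simp add: swap_letters_def)

lemma swap_letters_twice: "swap_letters i (swap_letters i y) = y"
  by (simp add: swap_letters_apply fun_eq_iff)

lemma swap_letters_braid:
  "swap_letters (Suc i) (swap_letters i (swap_letters (Suc i) y))
     = swap_letters i (swap_letters (Suc i) (swap_letters i y))"
  by (simp add: swap_letters_apply fun_eq_iff)

lemma swap_letters_commute:
  assumes "i \<noteq> j" "i \<noteq> Suc j" "j \<noteq> Suc i"
  shows "swap_letters i (swap_letters j y) = swap_letters j (swap_letters i y)"
  using assms by (simp add: swap_letters_apply fun_eq_iff)

text \<open>The Hecke operator, written out at the target \<open>y\<close>. It sends the point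
  function of \<open>x\<close> to that of \<open>swap_letters i x\<close> at an ascent of
  \<open>x\<close>, to \<open>r\<close> times that plus \<open>1 - r\<close> times the point
  function of \<open>x\<close> at a descent, and fixes it when the two letters agree.\<close>

definition swap_op :: "'k::field \<Rightarrow> nat \<Rightarrow> ((nat \<Rightarrow> nat) \<Rightarrow> 'k) \<Rightarrow> (nat \<Rightarrow> nat) \<Rightarrow> 'k"
  where "swap_op r i f y =
    (if y i < y (Suc i) then r * f (swap_letters i y)
     else if y (Suc i) < y i then f (swap_letters i y) + (1 - r) * f y
     else f y)"

lemma swap_op_quadratic: "swap_op r i (swap_op r i f) y = (1 - r) * swap_op r i f y + r * f y"
  by (simp add: swap_op_def swap_letters_apply swap_letters_twice algebra_simps)

lemma swap_op_commute:
  assumes "i \<noteq> j" "i \<noteq> Suc j" "j \<noteq> Suc i"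
  shows "swap_op r i (swap_op s j f) = swap_op s j (swap_op r i f)"
  using assms
  by (intro ext)
     (simp add: swap_op_def swap_letters_apply swap_letters_commute[OF assms] algebra_simps)

text \<open>Both sides compare only the three letters at \<open>i\<close>, \<open>i + 1\<close> and
  \<open>i + 2\<close>, so their relative order decides all conditionals.\<close>

lemma swap_op_braid:
  "swap_op r i (swap_op r (Suc i) (swap_op r i f)) = swap_op r (Suc i) (swap_op r i (swap_op r (Suc i) f))"
proof
  fix y
  show "swap_op r i (swap_op r (Suc i) (swap_op r i f)) y = swap_op r (Suc i) (swap_op r i (swap_op r (Suc i) f)) y"
    by (cases rule: linorder_cases[of "y i" "y (Suc i)"];
        cases rule: linorder_cases[of "y (Suc i)" "y (Suc (Suc i))"];
        cases rule: linorder_cases[of "y i" "y (Suc (Suc i))"])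
       (simp_all add: swap_op_def swap_letters_apply swap_letters_twice swap_letters_braid algebra_simps)
qed

section \<open>Zero, identity and Hecke operators, and direct sums of modules built from
  them\<close>

datatype op_mode = Kill | Fix | Swap

fun mode_op :: "op_mode \<Rightarrow> 'k::field \<Rightarrow> nat \<Rightarrow> ((nat \<Rightarrow> nat) \<Rightarrow> 'k) \<Rightarrow> (nat \<Rightarrow> nat) \<Rightarrow> 'k"
  where "mode_op Kill r i f = (\<lambda>y. 0)"
  | "mode_op Fix r i f = f"
  | "mode_op Swap r i f = swap_op r i f"

lemma mode_op_add: "mode_op a r i (\<lambda>x. f x + g x) = (\<lambda>x. mode_op a r i f x + mode_op a r i g x)"
  by (cases a) (auto simp: swap_op_def algebra_simps fun_eq_iff)

lemma mode_op_scale: "mode_op a r i (\<lambda>x. c * f x) = (\<lambda>x. c * mode_op a r i f x)"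
  by (cases a) (auto simp: swap_op_def algebra_simps fun_eq_iff)

lemma mode_op_quadratic:
  assumes "a = Kill \<Longrightarrow> r = 0"
  shows "mode_op a r i (mode_op a r i f) y = (1 - r) * mode_op a r i f y + r * f y"
  using assms by (cases a) (auto simp: swap_op_quadratic algebra_simps)

lemma swap_op_zero: "swap_op r i (\<lambda>y. 0) = (\<lambda>y. 0)"
  by (simp add: swap_op_def fun_eq_iff)

lemma mode_op_commute:
  assumes "i \<noteq> j" "i \<noteq> Suc j" "j \<noteq> Suc i"
  shows "mode_op a r i (mode_op b s j f) = mode_op b s j (mode_op a r i f)"
  by (cases a; cases b) (auto intro: swap_op_commute[OF assms] simp: swap_op_zero)

text \<open>An operator in mode \<open>Kill\<close> makes both sides 0. \<open>Swap\<close> next to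
  \<open>Fix\<close> turns the relation into idempotence of the Hecke operator, which holds for
  parameter 0.\<close>

lemma mode_op_braid:
  assumes "a = Swap \<Longrightarrow> b = Swap \<Longrightarrow> r = s"
    and "a = Swap \<Longrightarrow> b = Fix \<Longrightarrow> r = 0" and "a = Fix \<Longrightarrow> b = Swap \<Longrightarrow> s = 0"
  shows "mode_op a r i (mode_op b s (Suc i) (mode_op a r i f))
    = mode_op b s (Suc i) (mode_op a r i (mode_op b s (Suc i) f))"
proof -
  have "swap_op (0::'a) j (swap_op 0 j f) = swap_op 0 j f" for j
    by (simp add: swap_op_quadratic fun_eq_iff)
  then show ?thesis
    using assms by (cases a; cases b) (simp_all add: swap_op_braid swap_op_zero)
qed

text \<open>The first component indexes the summands of a direct sum of word modules. The operators
  do not mix summands, but each summand has its own mode for every generator.\<close>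

definition word_op ::
    "('c \<Rightarrow> nat \<Rightarrow> op_mode) \<Rightarrow> (nat \<Rightarrow> 'k::field) \<Rightarrow> nat \<Rightarrow>
      ('c \<times> (nat \<Rightarrow> nat) \<Rightarrow> 'k) \<Rightarrow> 'c \<times> (nat \<Rightarrow> nat) \<Rightarrow> 'k"
  where "word_op mode q i f = (\<lambda>(c, y). mode_op (mode c i) (q i) i (\<lambda>z. f (c, z)) y)"

lemma hecke_action_word_op:
  fixes q :: "nat \<Rightarrow> 'k::field" and mode :: "'c \<Rightarrow> nat \<Rightarrow> op_mode"
  assumes kill: "\<And>c i. 1 \<le> i \<Longrightarrow> i \<le> n \<Longrightarrow> mode c i = Kill \<Longrightarrow> q i = 0"
    and swap: "\<And>c i. 1 \<le> i \<Longrightarrow> i < n \<Longrightarrow> mode c i = Swap \<Longrightarrow> mode c (Suc i) = Swap \<Longrightarrow> q i = q (Suc i)"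
    and swap_fix: "\<And>c i. 1 \<le> i \<Longrightarrow> i < n \<Longrightarrow> mode c i = Swap \<Longrightarrow> mode c (Suc i) = Fix \<Longrightarrow> q i = 0"
    and fix_swap: "\<And>c i. 1 \<le> i \<Longrightarrow> i < n \<Longrightarrow> mode c i = Fix \<Longrightarrow> mode c (Suc i) = Swap \<Longrightarrow> q (Suc i) = 0"
  shows "hecke_action (word_op mode q) {1..n} coxeter_A q"
proof
  fix s :: nat and f :: "'c \<times> (nat \<Rightarrow> nat) \<Rightarrow> 'k" and x :: "'c \<times> (nat \<Rightarrow> nat)"
  assume s: "s \<in> {1..n}"
  obtain c y where "x = (c, y)" by force
  then show "word_op mode q s (word_op mode q s f) x = (1 - q s) * word_op mode q s f x + q s * f x"
    using mode_op_quadratic[of "mode c s" "q s" s "\<lambda>z. f (c, z)" y] kill[of s c] s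
    by (simp add: word_op_def[of mode q s])
next
  fix s t :: nat and f :: "'c \<times> (nat \<Rightarrow> nat) \<Rightarrow> 'k"
  assume s: "s \<in> {1..n}" and t: "t \<in> {1..n}" and m: "coxeter_A s t = 2"
  then have st: "s \<noteq> t" "s \<noteq> Suc t" "t \<noteq> Suc s"
    by (auto simp: coxeter_A_def)
  show "word_op mode q s (word_op mode q t f) = word_op mode q t (word_op mode q s f)"
  proof
    fix x :: "'c \<times> (nat \<Rightarrow> nat)"
    obtain c y where "x = (c, y)" by force
    then show "word_op mode q s (word_op mode q t f) x = word_op mode q t (word_op mode q s f) x"
      using mode_op_commute[OF st, of "mode c s" "q s" "mode c t" "q t" "\<lambda>z. f (c, z)"]
      by (simp add: word_op_def)
  qed
next
  fix s t :: nat and f :: "'c \<times> (nat \<Rightarrow> nat) \<Rightarrow> 'k"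
  assume s: "s \<in> {1..n}" and t: "t \<in> {1..n}" and m: "coxeter_A s t = 3"
  have *: "word_op mode q i (word_op mode q (Suc i) (word_op mode q i f))
      = word_op mode q (Suc i) (word_op mode q i (word_op mode q (Suc i) f))"
    if i: "1 \<le> i" "i < n" for i
  proof
    fix x :: "'c \<times> (nat \<Rightarrow> nat)"
    obtain c y where "x = (c, y)" by force
    then show "word_op mode q i (word_op mode q (Suc i) (word_op mode q i f)) x
      = word_op mode q (Suc i) (word_op mode q i (word_op mode q (Suc i) f)) x"
      using mode_op_braid[of "mode c i" "mode c (Suc i)" "q i" "q (Suc i)" i "\<lambda>z. f (c, z)"]
        swap[OF i, of c] swap_fix[OF i, of c] fix_swap[OF i, of c]
      by (simp add: word_op_def)
  qed
  from m have "t = Suc s \<or> s = Suc t"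
    by (auto simp: coxeter_A_def split: if_splits)
  then show "word_op mode q s (word_op mode q t (word_op mode q s f)) = word_op mode q t (word_op mode q s (word_op mode q t f))"
    using *[of s] *[of t] s t by auto
qed (auto simp: word_op_def mode_op_add mode_op_scale fun_eq_iff)

lemma mode_op_zero: "mode_op a r i (\<lambda>y. 0) = (\<lambda>y. 0)"
  by (cases a) (simp_all add: swap_op_zero)

text \<open>At an ascent no factor depending on the parameter appears, so basis vectors go to basis
  vectors; this is why \<open>reach\<close> moves along ascents only.\<close>

lemma word_op_swap_point:
  assumes mode: "mode c i = Swap" and asc: "x i < x (Suc i)"
  shows "word_op mode q i (\<lambda>y. of_bool (y = (c, x))) = (\<lambda>y. of_bool (y = (c, swap_letters i x)))"
proof
  fix d :: "'a \<times> (nat \<Rightarrow> nat)"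
  obtain c' y where d: "d = (c', y)" by force
  have eq: "swap_letters i y = x \<longleftrightarrow> y = swap_letters i x"
    by (metis swap_letters_twice)
  have "y i = x (Suc i) \<and> y (Suc i) = x i" if "y = swap_letters i x"
    using that by (simp add: swap_letters_apply)
  then show "word_op mode q i (\<lambda>y. of_bool (y = (c, x))) d = of_bool (d = (c, swap_letters i x))"
    using asc mode
    by (cases "c' = c") (auto simp: d word_op_def mode_op_zero swap_op_def eq)
qed

lemma collapse_free_adjacent:
  assumes "collapse_free {1..n} coxeter_A q" "1 \<le> i" "i < n"
  shows "q i = 0 \<or> q (Suc i) = 0 \<or> q i = q (Suc i)"
  using assms(1)[unfolded collapse_free_def, rule_format, of i "Suc i"] assms(2,3)
  by (auto simp: coxeter_A_def)

lemma noncommuting_generators: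
  fixes q :: "nat \<Rightarrow> 'k::field"
  assumes cf: "collapse_free {1..n} coxeter_A q"
    and k: "1 \<le> k" "k < n" and eq: "q k = q (Suc k)"
  shows "gen k * gen (Suc k) - gen (Suc k) * gen k \<notin> hecke_ideal {1..n} coxeter_A q"
proof
  assume *: "gen k * gen (Suc k) - gen (Suc k) * gen k \<in> hecke_ideal {1..n} coxeter_A q"
  \<comment> \<open>If the common parameter is 0, all other generators may act as the identity. If
    it is nonzero, all positions with nonzero parameter act by Hecke operators, neighbours among
    them agreeing by collapse-freeness, and the positions with parameter 0 act by 0.\<close>
  define mode :: "unit \<Rightarrow> nat \<Rightarrow> op_mode" where
    "mode = (\<lambda>_ i. if q k = 0 then if i = k \<or> i = Suc k then Swap else Fix
             else if q i = 0 then Kill else Swap)"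
  note cf' = collapse_free_adjacent[OF cf]
  interpret hecke_action "word_op mode q" "{1..n}" coxeter_A q
    by (rule hecke_action_word_op) (use cf' eq in \<open>auto simp: mode_def split: if_splits\<close>)
  let ?x = "\<lambda>i::nat. i"
  let ?v = "\<lambda>y. of_bool (y = ((), ?x)) :: 'k"
  have mode_k: "mode () k = Swap" "mode () (Suc k) = Swap"
    using eq by (auto simp: mode_def)
  have 1: "act (word_op mode q) (gen k * gen (Suc k)) ?v
      = (\<lambda>y. of_bool (y = ((), swap_letters k (swap_letters (Suc k) ?x))))"
    unfolding act_mult act_gen
    by (subst word_op_swap_point, use mode_k in \<open>simp_all add: word_op_swap_point swap_letters_apply\<close>)
  have 2: "act (word_op mode q) (gen (Suc k) * gen k) ?v
      = (\<lambda>y. of_bool (y = ((), swap_letters (Suc k) (swap_letters k ?x))))"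
    unfolding act_mult act_gen
    by (subst word_op_swap_point, use mode_k in \<open>simp_all add: word_op_swap_point swap_letters_apply\<close>)
  let ?y = "swap_letters k (swap_letters (Suc k) ?x)"
  \<comment> \<open>From the identity word, one product brings the letter \<open>k + 2\<close> to
    place \<open>k\<close>, the other the letter \<open>k + 1\<close>.\<close>
  have "?y k \<noteq> swap_letters (Suc k) (swap_letters k ?x) k"
    by (simp add: swap_letters_apply)
  then have "?y \<noteq> swap_letters (Suc k) (swap_letters k ?x)"
    by auto
  then show False
    using fun_cong[OF act_hecke_ideal[OF *, of ?v], of "((), ?y)"]
    unfolding act_diff 1 2 by simp
qed

text \<open>
  For a set \<open>S\<close> of positions with parameter 0, the generators at these positions act by 1 or 0
  according to membership in \<open>S\<close>; every block of nonzero parameters next to an element of \<open>S\<close>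
  then has to act trivially.
\<close>

definition blocked :: "(nat \<Rightarrow> 'k::zero) \<Rightarrow> nat set \<Rightarrow> nat \<Rightarrow> bool"
  where "blocked q S i \<longleftrightarrow>
    (\<exists>z\<in>S. q z = 0 \<and> (\<forall>j. z < j \<and> j \<le> i \<or> i \<le> j \<and> j < z \<longrightarrow> q j \<noteq> 0))"

definition block_mode :: "(nat \<Rightarrow> 'k::zero) \<Rightarrow> nat set \<Rightarrow> nat \<Rightarrow> op_mode"
  where "block_mode q S i =
    (if q i = 0 then if i \<in> S then Fix else Kill else if blocked q S i then Fix else Swap)"

text \<open>The blocking position \<open>z\<close> has parameter 0, so it is neither
  \<open>i\<close> nor \<open>Suc i\<close>; the two intervals up to \<open>z\<close> differ at most
  by these two positions, whose parameters are nonzero.\<close>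

lemma blocked_Suc:
  assumes "q i \<noteq> 0" "q (Suc i) \<noteq> 0"
  shows "blocked q S (Suc i) \<longleftrightarrow> blocked q S i"
proof -
  let ?between = "\<lambda>z i j. z < j \<and> j \<le> i \<or> i \<le> j \<and> j < z"
  have "(\<forall>j. ?between z (Suc i) j \<longrightarrow> q j \<noteq> 0) \<longleftrightarrow> (\<forall>j. ?between z i j \<longrightarrow> q j \<noteq> 0)"
    if "q z = 0" for z
  proof -
    have "z < i \<or> Suc i < z"
      using assms that by (metis linorder_neqE_nat Suc_lessI)
    then have "?between z (Suc i) j \<or> j = i \<or> j = Suc i \<longleftrightarrow> ?between z i j \<or> j = i \<or> j = Suc i" for j
      by linarith
    then show ?thesis
      using assms by metis
  qed
  then show ?thesis
    unfolding blocked_def by blast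
qed

lemma blocked_next:
  assumes "q i \<noteq> 0" "q (Suc i) = 0" "Suc i \<in> S"
  shows "blocked q S i"
  unfolding blocked_def using assms by (intro bexI[of _ "Suc i"]) (auto simp: less_Suc_eq_le)

lemma blocked_prev:
  assumes "q i = 0" "q (Suc i) \<noteq> 0" "i \<in> S"
  shows "blocked q S (Suc i)"
  unfolding blocked_def using assms by (intro bexI[of _ "i"]) (auto simp: le_Suc_eq)

text \<open>Mode \<open>Swap\<close> occurs only at nonzero parameters, so adjacent ones agree by
  collapse-freeness. \<open>Swap\<close> never borders on \<open>Fix\<close>: being blocked is
  constant within a block, and a zero position in \<open>S\<close> blocks its neighbours with
  nonzero parameter. The conditions on such pairs thus hold vacuously.\<close>

lemma hecke_action_block_mode:
  fixes q :: "nat \<Rightarrow> 'k::field"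
  assumes "collapse_free {1..n} coxeter_A q"
  shows "hecke_action (word_op (block_mode q) q) {1..n} coxeter_A q"
proof -
  note cf = collapse_free_adjacent[OF assms]
  show ?thesis
  proof (rule hecke_action_word_op)
    fix S i assume "block_mode q S i = Kill"
    then show "q i = 0" by (auto simp: block_mode_def split: if_splits)
  next
    fix S i assume "1 \<le> i" "i < n" "block_mode q S i = Swap" "block_mode q S (Suc i) = Swap"
    then show "q i = q (Suc i)"
      using cf[of i] by (auto simp: block_mode_def split: if_splits)
  next
    fix S i assume "block_mode q S i = Swap" "block_mode q S (Suc i) = Fix"
    then show "q i = 0"
      using blocked_Suc[of q i S] blocked_next[of q i S] by (auto simp: block_mode_def split: if_splits)
  next
    fix S i assume "block_mode q S i = Fix" "block_mode q S (Suc i) = Swap"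
    then show "q (Suc i) = 0"
      using blocked_Suc[of q i S] blocked_prev[of q i S] by (auto simp: block_mode_def split: if_splits)
  qed
qed

section \<open>Words reached by ascents, and the orbit of one vector\<close>

inductive reach :: "(nat \<Rightarrow> 'k::zero) \<Rightarrow> nat set \<Rightarrow> nat \<Rightarrow> (nat \<Rightarrow> nat) \<Rightarrow> bool"
  for q S m
  where start: "reach q S m (\<lambda>i. i)"
  | step: "reach q S m x \<Longrightarrow> 1 \<le> i \<Longrightarrow> i \<le> m \<Longrightarrow> block_mode q S i = Swap \<Longrightarrow> x i < x (Suc i) \<Longrightarrow>
             reach q S m (swap_letters i x)"

lemma reach_mono:
  assumes "reach q S m x" "m \<le> m'"
    and "\<And>i. 1 \<le> i \<Longrightarrow> i \<le> m \<Longrightarrow> block_mode q S i = Swap \<Longrightarrow> block_mode q S' i = Swap"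
  shows "reach q S' m' x"
  using assms(1)
proof induction
  case start
  show ?case by (rule reach.start)
next
  case (step x i)
  then show ?case using assms(2,3) by (intro reach.step) auto
qed

text \<open>The sum of the basis vectors at the identity word over all admissible \<open>S\<close>:
  independence is tested on the orbit of a single vector, which must therefore meet every
  summand.\<close>

definition start_vector :: "nat \<Rightarrow> (nat \<Rightarrow> 'k::field) \<Rightarrow> nat set \<times> (nat \<Rightarrow> nat) \<Rightarrow> 'k"
  where "start_vector n q = (\<lambda>(S, x). of_bool (x = (\<lambda>i. i) \<and> S \<subseteq> {i\<in>{1..n}. q i = 0}))"

text \<open>A product of factors \<open>gen i\<close> and \<open>1 - gen i\<close> over the zero
  positions isolates the summand \<open>S\<close>; the ascents recorded in \<open>reach\<close> then
  carry the identity word to \<open>x\<close>.\<close>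

lemma point_in_orbit:
  fixes q :: "nat \<Rightarrow> 'k::field"
  assumes cf: "collapse_free {1..n} coxeter_A q"
    and S: "S \<subseteq> {i\<in>{1..n}. q i = 0}" and x: "reach q S n x"
  shows "\<exists>p\<in>carrier (free_algebra {1..n}).
    act (word_op (block_mode q) q) p (start_vector n q) = (\<lambda>y. of_bool (y = (S, x)))"
proof -
  let ?Z = "{i\<in>{1..n}. q i = 0}" and ?T = "word_op (block_mode q) q" and ?F = "free_algebra {1..n}"
  interpret hecke_action ?T "{1..n}" coxeter_A q
    by (rule hecke_action_block_mode[OF cf])
  have zero_op: "?T i f (S', y) = (if i \<in> S' then f (S', y) else 0)" if "i \<in> ?Z" for i f S' y
    using that by (simp add: word_op_def block_mode_def)
  \<comment> \<open>After the factors for the positions in \<open>B\<close>, exactly those summands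
    survive whose index agrees with \<open>S\<close> on \<open>B\<close>.\<close>
  have "\<exists>p\<in>carrier ?F. act ?T p (start_vector n q)
      = (\<lambda>(S', y). of_bool (y = (\<lambda>i. i) \<and> S' \<subseteq> ?Z \<and> S' \<inter> B = S \<inter> B))"
    if "finite B" "B \<subseteq> ?Z" for B
    using that
  proof (induction B rule: finite_induct)
    case empty
    show ?case
      by (intro bexI[of _ 1]) (auto simp: act_one start_vector_def)
  next
    case (insert i B)
    then obtain p where p: "p \<in> carrier ?F" and pv: "act ?T p (start_vector n q)
      = (\<lambda>(S', y). of_bool (y = (\<lambda>i. i) \<and> S' \<subseteq> ?Z \<and> S' \<inter> B = S \<inter> B))" by auto
    have i: "i \<in> ?Z" using insert by simp
    let ?g = "if i \<in> S then gen i else 1 - gen i"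
    have "act ?T (?g * p) (start_vector n q)
      = (\<lambda>(S', y). of_bool (y = (\<lambda>i. i) \<and> S' \<subseteq> ?Z \<and> S' \<inter> insert i B = S \<inter> insert i B))"
    proof (intro ext, clarify)
      fix S' y
      have "S' \<inter> insert i B = S \<inter> insert i B \<longleftrightarrow> (i \<in> S' \<longleftrightarrow> i \<in> S) \<and> S' \<inter> B = S \<inter> B"
        using insert.hyps by blast
      then show "act ?T (?g * p) (start_vector n q) (S', y)
        = of_bool (y = (\<lambda>i. i) \<and> S' \<subseteq> ?Z \<and> S' \<inter> insert i B = S \<inter> insert i B)"
        unfolding act_mult pv by (simp add: act_diff act_gen act_one zero_op[OF i])
    qed
    moreover have "?g * p \<in> carrier ?F"
      using p i by auto
    ultimately show ?case by blast
  qed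
  from this[of ?Z] obtain p where p: "p \<in> carrier ?F" "act ?T p (start_vector n q)
      = (\<lambda>(S', y). of_bool (y = (\<lambda>i. i) \<and> S' \<subseteq> ?Z \<and> S' \<inter> ?Z = S \<inter> ?Z))"
    by auto
  have "act ?T p (start_vector n q) = (\<lambda>y. of_bool (y = (S, \<lambda>i. i)))"
    unfolding p(2) using S by (auto simp: fun_eq_iff)
  then have start: "\<exists>p\<in>carrier ?F. act ?T p (start_vector n q) = (\<lambda>y. of_bool (y = (S, \<lambda>i. i)))"
    using p(1) by blast
  from x show ?thesis
  proof induction
    case start
    show ?case by (rule \<open>\<exists>p\<in>carrier ?F. act ?T p (start_vector n q) = (\<lambda>y. of_bool (y = (S, \<lambda>i. i)))\<close>)
  next
    case (step x i)
    then obtain p where p: "p \<in> carrier ?F"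
      "act ?T p (start_vector n q) = (\<lambda>y. of_bool (y = (S, x)))" by blast
    have "act ?T (gen i * p) (start_vector n q) = (\<lambda>y. of_bool (y = (S, swap_letters i x)))"
      unfolding act_mult p(2) act_gen using step by (intro word_op_swap_point) auto
    then show ?case
      using p(1) step.hyps by (intro bexI[of _ "gen i * p"]) auto
  qed
qed

lemma swap_letters_inject: "swap_letters i x = swap_letters i y \<longleftrightarrow> x = y"
  by (metis swap_letters_twice)

section \<open>Counting points in the orbit\<close>

text \<open>
  Inductive invariant for the first \<open>k\<close> positions: \<open>A\<close> consists of reachable points, \<open>D\<close> of those
  for which the block containing position \<open>k\<close> may still act nontrivially, and \<open>Z\<close> of those which stay
  reachable when a further element adjacent to that block is put into the set \<open>S\<close>.
\<close>

definition orbit_family ::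
    "(nat \<Rightarrow> 'k::zero) \<Rightarrow> nat \<Rightarrow> (nat set \<times> (nat \<Rightarrow> nat)) set \<Rightarrow> (nat set \<times> (nat \<Rightarrow> nat)) set \<Rightarrow>
      (nat set \<times> (nat \<Rightarrow> nat)) set \<Rightarrow> bool"
  where "orbit_family q k A D Z \<longleftrightarrow> finite A \<and> D \<subseteq> A \<and> Z \<subseteq> A \<and>
    (\<forall>S x. (S, x) \<in> A \<longrightarrow> S \<subseteq> {i\<in>{1..k}. q i = 0} \<and> (\<forall>j\<le>Suc k. x j \<le> Suc k) \<and>
       (\<forall>j>Suc k. x j = j) \<and> reach q S k x) \<and>
    (\<forall>S x. (S, x) \<in> D \<longrightarrow> (\<forall>z\<in>S. \<exists>j>z. j \<le> k \<and> q j = 0)) \<and>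
    (\<forall>S x. (S, x) \<in> Z \<longrightarrow> (\<exists>l\<le>k. (l = 0 \<or> q l = 0) \<and> reach q S l x))"

lemma orbit_familyD:
  assumes "orbit_family q k A D Z"
  shows "finite A" "D \<subseteq> A" "Z \<subseteq> A"
    and "(S, x) \<in> A \<Longrightarrow> S \<subseteq> {i\<in>{1..k}. q i = 0}"
    and "(S, x) \<in> A \<Longrightarrow> j \<le> Suc k \<Longrightarrow> x j \<le> Suc k"
    and "(S, x) \<in> A \<Longrightarrow> Suc k < j \<Longrightarrow> x j = j"
    and "(S, x) \<in> A \<Longrightarrow> reach q S k x"
    and "(S, x) \<in> D \<Longrightarrow> z \<in> S \<Longrightarrow> \<exists>j>z. j \<le> k \<and> q j = 0"
    and "(S, x) \<in> Z \<Longrightarrow> \<exists>l\<le>k. (l = 0 \<or> q l = 0) \<and> reach q S l x"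
  using assms[unfolded orbit_family_def] by (elim conjE; meson)+

lemma orbit_familyI:
  assumes "finite A" "D \<subseteq> A" "Z \<subseteq> A"
    and "\<And>S x. (S, x) \<in> A \<Longrightarrow> S \<subseteq> {i\<in>{1..k}. q i = 0}"
    and "\<And>S x j. (S, x) \<in> A \<Longrightarrow> j \<le> Suc k \<Longrightarrow> x j \<le> Suc k"
    and "\<And>S x j. (S, x) \<in> A \<Longrightarrow> Suc k < j \<Longrightarrow> x j = j"
    and "\<And>S x. (S, x) \<in> A \<Longrightarrow> reach q S k x"
    and "\<And>S x z. (S, x) \<in> D \<Longrightarrow> z \<in> S \<Longrightarrow> \<exists>j>z. j \<le> k \<and> q j = 0"
    and "\<And>S x. (S, x) \<in> Z \<Longrightarrow> \<exists>l\<le>k. (l = 0 \<or> q l = 0) \<and> reach q S l x"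
  shows "orbit_family q k A D Z"
  unfolding orbit_family_def by (intro conjI allI impI ballI; rule assms; assumption)

lemma orbit_family_0: "orbit_family q 0 {({}, \<lambda>i. i)} {({}, \<lambda>i. i)} {({}, \<lambda>i. i)}"
  by (rule orbit_familyI) (auto intro: reach.start)

text \<open>Old points remain, and every point of \<open>Z\<close> gets a copy with
  \<open>Suc k\<close> put into its set. For old points, \<open>Suc k\<close> is a zero position
  beyond the whole set, so all of \<open>A\<close> can serve as the new \<open>D\<close>; as
  \<open>Suc k\<close> itself is a zero position, every point can serve in the new
  \<open>Z\<close>.\<close>

lemma orbit_family_zero_step:
  assumes fam: "orbit_family q k A D Z" and q: "q (Suc k) = 0"
  defines "B \<equiv> (\<lambda>(S, x). (insert (Suc k) S, x)) ` Z"
  shows "orbit_family q (Suc k) (A \<union> B) A (A \<union> B)" "card (A \<union> B) = card A + card Z"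
proof -
  note fam = orbit_familyD[OF fam]
  have B: "\<exists>S. T = insert (Suc k) S \<and> (S, x) \<in> Z" if "(T, x) \<in> B" for T x
    using that by (auto simp: B_def)
  have reach_A: "reach q S (Suc k) x" if "(S, x) \<in> A" for S x
    using fam(7)[OF that] by (rule reach_mono) auto
  have reach_B: "reach q (insert (Suc k) S) (Suc k) x" if Z: "(S, x) \<in> Z" for S x
  proof -
    from fam(9)[OF Z] obtain l where l: "l \<le> k" "l = 0 \<or> q l = 0" "reach q S l x" by blast
    show ?thesis
      using l(3)
    proof (rule reach_mono)
      fix i assume i: "1 \<le> i" "i \<le> l" "block_mode q S i = Swap"
      \<comment> \<open>Here \<open>1 \<le> i \<le> l\<close> rules out \<open>l = 0\<close>. The
        zero position \<open>l\<close> lies between \<open>i\<close> and \<open>Suc k\<close>, so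
        adding \<open>Suc k\<close> to the set does not block \<open>i\<close>.\<close>
      then have "q l = 0" using l by auto
      with i l(1) have "\<not> blocked q (insert (Suc k) S) i"
        by (auto simp: block_mode_def blocked_def split: if_splits)
      then show "block_mode q (insert (Suc k) S) i = Swap"
        using i by (auto simp: block_mode_def split: if_splits)
    qed (use l in simp)
  qed
  show "orbit_family q (Suc k) (A \<union> B) A (A \<union> B)"
  proof (rule orbit_familyI)
    show "finite (A \<union> B)"
      using fam(1,3) by (auto simp: B_def intro: finite_subset)
    show "S \<subseteq> {i \<in> {1..Suc k}. q i = 0}" if "(S, x) \<in> A \<union> B" for S x
      using that fam(3) fam(4) q by (fastforce dest: B)
    show "x j \<le> Suc (Suc k)" if Sx: "(S, x) \<in> A \<union> B" and j: "j \<le> Suc (Suc k)" for S x j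
    proof -
      obtain S' where "(S', x) \<in> A" using Sx B[of S x] fam(3) by blast
      then show ?thesis
        using fam(5)[of S' x j] fam(6)[of S' x j] j by (cases "j \<le> Suc k") auto
    qed
    show "x j = j" if Sx: "(S, x) \<in> A \<union> B" and j: "Suc (Suc k) < j" for S x j
    proof -
      obtain S' where "(S', x) \<in> A" using Sx B[of S x] fam(3) by blast
      then show ?thesis
        using fam(6)[of S' x j] j by auto
    qed
    show r: "reach q S (Suc k) x" if "(S, x) \<in> A \<union> B" for S x
      using that reach_A reach_B B[of S x] by blast
    show "\<exists>j>z. j \<le> Suc k \<and> q j = 0" if "(S, x) \<in> A" "z \<in> S" for S x z
      using fam(4)[OF that(1)] that(2) q by (intro exI[of _ "Suc k"]) auto
    show "\<exists>l\<le>Suc k. (l = 0 \<or> q l = 0) \<and> reach q S l x" if "(S, x) \<in> A \<union> B" for S x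
      using r[OF that] q by blast
  qed auto
  have notin: "Suc k \<notin> S" if "(S, x) \<in> A" for S x
    using fam(4)[OF that] by auto
  have "A \<inter> B = {}"
    using notin by (auto simp: B_def)
  moreover have "card B = card Z"
    unfolding B_def
  proof (rule card_image)
    have "S = S'" if "(S, x) \<in> Z" "(S', x) \<in> Z" "insert (Suc k) S = insert (Suc k) S'" for S S' x
      using that notin fam(3) by (metis insert_ident subsetD)
    then show "inj_on (\<lambda>(S, x). (insert (Suc k) S, x)) Z"
      by (auto simp: inj_on_def)
  qed
  ultimately show "card (A \<union> B) = card A + card Z"
    using fam(1,3) by (subst card_Un_disjoint) (auto simp: B_def intro: finite_subset)
qed

context
  fixes q :: "nat \<Rightarrow> 'k::zero" and k A D Z
  assumes fam: "orbit_family q k A D Z" and q: "q (Suc k) \<noteq> 0"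
begin

text \<open>For points of \<open>D\<close>, every element of the set is followed by a zero position
  up to \<open>k\<close>, which shields \<open>k\<close> and \<open>Suc k\<close> from it.\<close>

private lemma not_blocked:
  assumes "(S, x) \<in> D" "i = Suc k \<or> i = k"
  shows "\<not> blocked q S i"
proof
  assume "blocked q S i"
  then obtain z where z: "z \<in> S" "\<And>j. z < j \<and> j \<le> i \<Longrightarrow> q j \<noteq> 0"
    by (auto simp: blocked_def)
  from orbit_familyD(8)[OF fam assms(1) z(1)] z(2) assms(2) show False
    by force
qed

text \<open>The letter \<open>Suc (Suc k)\<close> still stands in its own place and exceeds all
  letters before it, so exchanging it with its left neighbour is an ascent.\<close>

private lemma swap_one:
  assumes "(S, x) \<in> D"
  shows "swap_letters (Suc k) x (Suc k) = Suc (Suc k)"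
    and "swap_letters (Suc k) x (Suc (Suc k)) \<le> Suc k"
    and "j \<noteq> Suc k \<Longrightarrow> j \<noteq> Suc (Suc k) \<Longrightarrow> swap_letters (Suc k) x j = x j"
    and "reach q S (Suc k) (swap_letters (Suc k) x)"
proof -
  from assms have A: "(S, x) \<in> A" using orbit_familyD(2)[OF fam] by blast
  note x = orbit_familyD(5,6,7)[OF fam A]
  show "swap_letters (Suc k) x (Suc k) = Suc (Suc k)" "swap_letters (Suc k) x (Suc (Suc k)) \<le> Suc k"
    "j \<noteq> Suc k \<Longrightarrow> j \<noteq> Suc (Suc k) \<Longrightarrow> swap_letters (Suc k) x j = x j"
    using x(1)[of "Suc k"] x(2)[of "Suc (Suc k)"] by (auto simp: swap_letters_apply)
  have "reach q S (Suc k) x"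
    using x(3) by (rule reach_mono) auto
  moreover have "block_mode q S (Suc k) = Swap"
    using q not_blocked[OF assms] by (simp add: block_mode_def)
  ultimately show "reach q S (Suc k) (swap_letters (Suc k) x)"
    using x(1)[of "Suc k"] x(2)[of "Suc (Suc k)"] by (intro reach.step) auto
qed

text \<open>The same largest letter moves one place further left, inside a block that contains both
  \<open>k\<close> and \<open>Suc k\<close>.\<close>

private lemma swap_two:
  assumes "(S, x) \<in> D" and k: "k \<noteq> 0" "q k \<noteq> 0"
  defines "y \<equiv> swap_letters k (swap_letters (Suc k) x)"
  shows "y k = Suc (Suc k)" "y (Suc k) \<le> Suc k" "y (Suc (Suc k)) \<le> Suc k"
    and "j \<noteq> k \<Longrightarrow> j \<noteq> Suc k \<Longrightarrow> j \<noteq> Suc (Suc k) \<Longrightarrow> y j = x j"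
    and "reach q S (Suc k) y"
proof -
  from assms have A: "(S, x) \<in> A" using orbit_familyD(2)[OF fam] by blast
  note one = swap_one[OF assms(1)] and x = orbit_familyD(5)[OF fam A, of k]
  show "y k = Suc (Suc k)" "y (Suc k) \<le> Suc k" "y (Suc (Suc k)) \<le> Suc k"
    "j \<noteq> k \<Longrightarrow> j \<noteq> Suc k \<Longrightarrow> j \<noteq> Suc (Suc k) \<Longrightarrow> y j = x j"
    using one(1,2) one(3)[of k] one(3)[of j] x by (auto simp: y_def swap_letters_apply[of k])
  have "block_mode q S k = Swap"
    using k not_blocked[OF assms(1)] by (simp add: block_mode_def)
  then show "reach q S (Suc k) y"
    unfolding y_def using one(1) one(3)[of k] x k by (intro reach.step[OF one(4)]) auto
qed

text \<open>In \<open>A\<close>, \<open>B\<close> and \<open>C\<close> the letter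
  \<open>Suc (Suc k)\<close> stands zero, one or two places left of its own place. This keeps the
  three sets disjoint.\<close>

private abbreviation "B \<equiv> (\<lambda>(S, x). (S, swap_letters (Suc k) x)) ` D"
private abbreviation "C \<equiv> (\<lambda>(S, x). (S, swap_letters k (swap_letters (Suc k) x))) ` D"

private lemma A_facts:
  assumes "(S, x) \<in> A"
  shows "S \<subseteq> {i \<in> {1..Suc k}. q i = 0}" "j \<le> Suc (Suc k) \<Longrightarrow> x j \<le> Suc (Suc k)"
    "Suc (Suc k) < j \<Longrightarrow> x j = j" "reach q S (Suc k) x" "x (Suc (Suc k)) = Suc (Suc k)"
proof -
  note x = orbit_familyD(4,5,6,7)[OF fam assms]
  show "S \<subseteq> {i \<in> {1..Suc k}. q i = 0}" using x(1) by auto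
  show "j \<le> Suc (Suc k) \<Longrightarrow> x j \<le> Suc (Suc k)" "Suc (Suc k) < j \<Longrightarrow> x j = j"
    "x (Suc (Suc k)) = Suc (Suc k)"
    using x(2,3)[of j] x(3)[of "Suc (Suc k)"] by (cases "j \<le> Suc k"; auto)+
  show "reach q S (Suc k) x"
    using x(4) by (rule reach_mono) auto
qed

private lemma B_facts:
  assumes "(S, x) \<in> B"
  shows "\<exists>x'. (S, x') \<in> D" "S \<subseteq> {i \<in> {1..Suc k}. q i = 0}" "j \<le> Suc (Suc k) \<Longrightarrow> x j \<le> Suc (Suc k)"
    "Suc (Suc k) < j \<Longrightarrow> x j = j" "reach q S (Suc k) x"
    "x (Suc k) = Suc (Suc k)" "x (Suc (Suc k)) \<le> Suc k"
proof -
  from assms obtain x' where D: "(S, x') \<in> D" and x: "x = swap_letters (Suc k) x'" by auto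
  then have A: "(S, x') \<in> A" using orbit_familyD(2)[OF fam] by blast
  note one = swap_one[OF D, folded x] and a = A_facts[OF A]
  show "\<exists>x'. (S, x') \<in> D" "S \<subseteq> {i \<in> {1..Suc k}. q i = 0}" "reach q S (Suc k) x"
    "x (Suc k) = Suc (Suc k)" "x (Suc (Suc k)) \<le> Suc k"
    using D one(1,2,4) a(1) by blast+
  show "j \<le> Suc (Suc k) \<Longrightarrow> x j \<le> Suc (Suc k)" "Suc (Suc k) < j \<Longrightarrow> x j = j"
    using one(1,2) one(3)[of j] a(2,3)[of j]
    by (cases "j = Suc k"; cases "j = Suc (Suc k)"; auto)+
qed

private lemma C_facts:
  assumes "(S, x) \<in> C" and k: "k \<noteq> 0" "q k \<noteq> 0"
  shows "\<exists>x'. (S, x') \<in> D" "S \<subseteq> {i \<in> {1..Suc k}. q i = 0}" "j \<le> Suc (Suc k) \<Longrightarrow> x j \<le> Suc (Suc k)"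
    "Suc (Suc k) < j \<Longrightarrow> x j = j" "reach q S (Suc k) x"
    "x (Suc k) \<le> Suc k" "x (Suc (Suc k)) \<le> Suc k"
proof -
  from assms obtain x' where D: "(S, x') \<in> D" and x: "x = swap_letters k (swap_letters (Suc k) x')" by auto
  then have A: "(S, x') \<in> A" using orbit_familyD(2)[OF fam] by blast
  note two = swap_two[OF D k, folded x] and a = A_facts[OF A]
  show "\<exists>x'. (S, x') \<in> D" "S \<subseteq> {i \<in> {1..Suc k}. q i = 0}" "reach q S (Suc k) x"
    "x (Suc k) \<le> Suc k" "x (Suc (Suc k)) \<le> Suc k"
    using D two(2,3,5) a(1) by blast+
  show "j \<le> Suc (Suc k) \<Longrightarrow> x j \<le> Suc (Suc k)" "Suc (Suc k) < j \<Longrightarrow> x j = j"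
    using two(1,2,3) two(4)[of j] a(2,3)[of j]
    by (cases "j = k"; cases "j = Suc k"; cases "j = Suc (Suc k)"; auto)+
qed

private lemma D_step:
  assumes "(S, x) \<in> D" "z \<in> S"
  shows "\<exists>j>z. j \<le> Suc k \<and> q j = 0"
  using orbit_familyD(8)[OF fam assms] le_Suc_eq by blast

private lemma Z_step:
  assumes "(S, x) \<in> Z"
  shows "\<exists>l\<le>Suc k. (l = 0 \<or> q l = 0) \<and> reach q S l x"
  using orbit_familyD(9)[OF fam assms] le_Suc_eq by blast

private lemma finite_families: "finite A" "finite D"
  using orbit_familyD(1,2)[OF fam] finite_subset by blast+

private lemma disjoint_AB: "A \<inter> B = {}"
proof (rule equals0I)
  fix p assume p: "p \<in> A \<inter> B"
  obtain S x where "p = (S, x)" by force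
  with p show False using A_facts(5)[of S x] B_facts(7)[of S x] by simp
qed

private lemma disjoint_C:
  assumes "k \<noteq> 0" "q k \<noteq> 0"
  shows "A \<inter> C = {}" "B \<inter> C = {}"
proof -
  have False if p: "p \<in> (A \<union> B) \<inter> C" for p
  proof -
    obtain S x where "p = (S, x)" by force
    with p show False
      using A_facts(5)[of S x] B_facts(6)[of S x] C_facts(6,7)[of S x, OF _ assms]
      by (metis Int_iff Suc_n_not_le_n Un_iff)
  qed
  then show "A \<inter> C = {}" "B \<inter> C = {}" by blast+
qed

private lemma card_B: "card B = card D"
  by (rule card_image) (auto simp: inj_on_def swap_letters_inject)

text \<open>Meant for a position \<open>Suc k\<close> that opens a block. The set \<open>Z\<close>
  does not grow, since the new words use the last block.\<close>

lemma orbit_family_first_step: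
  "orbit_family q (Suc k) (A \<union> B) (D \<union> B) Z"
  "card (A \<union> B) = card A + card D" "card (D \<union> B) = 2 * card D"
proof -
  show "orbit_family q (Suc k) (A \<union> B) (D \<union> B) Z"
  proof (rule orbit_familyI)
    show "finite (A \<union> B)" "D \<union> B \<subseteq> A \<union> B" "Z \<subseteq> A \<union> B"
      using finite_families orbit_familyD(2,3)[OF fam] by auto
    fix S x
    show "S \<subseteq> {i \<in> {1..Suc k}. q i = 0}" if "(S, x) \<in> A \<union> B"
      using that A_facts(1) B_facts(2) by blast
    show "x j \<le> Suc (Suc k)" if "(S, x) \<in> A \<union> B" "j \<le> Suc (Suc k)" for j
      using that A_facts(2) B_facts(3) by blast
    show "x j = j" if "(S, x) \<in> A \<union> B" "Suc (Suc k) < j" for j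
      using that A_facts(3) B_facts(4) by blast
    show "reach q S (Suc k) x" if "(S, x) \<in> A \<union> B"
      using that A_facts(4) B_facts(5) by blast
    show "\<exists>j>z. j \<le> Suc k \<and> q j = 0" if "(S, x) \<in> D \<union> B" "z \<in> S" for z
      using that D_step B_facts(1) by blast
    show "\<exists>l\<le>Suc k. (l = 0 \<or> q l = 0) \<and> reach q S l x" if "(S, x) \<in> Z"
      using that by (rule Z_step)
  qed
  have "D \<inter> B = {}" using disjoint_AB orbit_familyD(2)[OF fam] by blast
  then show "card (A \<union> B) = card A + card D" "card (D \<union> B) = 2 * card D"
    using disjoint_AB finite_families card_B by (simp_all add: card_Un_disjoint)
qed

text \<open>Moving the new letter at most two places does not produce all words of a long block, but
  tripling \<open>D\<close> is enough growth for the Fibonacci bounds.\<close>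

lemma orbit_family_next_step:
  assumes k: "k \<noteq> 0" "q k \<noteq> 0"
  shows "orbit_family q (Suc k) (A \<union> B \<union> C) (D \<union> B \<union> C) Z"
    "card (A \<union> B \<union> C) = card A + 2 * card D" "card (D \<union> B \<union> C) = 3 * card D"
proof -
  note C_facts = C_facts[OF _ k]
  show "orbit_family q (Suc k) (A \<union> B \<union> C) (D \<union> B \<union> C) Z"
  proof (rule orbit_familyI)
    show "finite (A \<union> B \<union> C)" "D \<union> B \<union> C \<subseteq> A \<union> B \<union> C" "Z \<subseteq> A \<union> B \<union> C"
      using finite_families orbit_familyD(2,3)[OF fam] by auto
    fix S x
    show "S \<subseteq> {i \<in> {1..Suc k}. q i = 0}" if "(S, x) \<in> A \<union> B \<union> C"
      using that A_facts(1) B_facts(2) C_facts(2) by blast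
    show "x j \<le> Suc (Suc k)" if "(S, x) \<in> A \<union> B \<union> C" "j \<le> Suc (Suc k)" for j
      using that A_facts(2) B_facts(3) C_facts(3) by blast
    show "x j = j" if "(S, x) \<in> A \<union> B \<union> C" "Suc (Suc k) < j" for j
      using that A_facts(3) B_facts(4) C_facts(4) by blast
    show "reach q S (Suc k) x" if "(S, x) \<in> A \<union> B \<union> C"
      using that A_facts(4) B_facts(5) C_facts(5) by blast
    show "\<exists>j>z. j \<le> Suc k \<and> q j = 0" if "(S, x) \<in> D \<union> B \<union> C" "z \<in> S" for z
      using that D_step B_facts(1) C_facts(1) by blast
    show "\<exists>l\<le>Suc k. (l = 0 \<or> q l = 0) \<and> reach q S l x" if "(S, x) \<in> Z"
      using that by (rule Z_step)
  qed
  note disjoint_C = disjoint_C[OF k]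
  have "card C = card D"
    by (rule card_image) (auto simp: inj_on_def swap_letters_inject)
  moreover have "D \<inter> B = {}" "D \<inter> C = {}"
    using disjoint_AB disjoint_C orbit_familyD(2)[OF fam] by blast+
  ultimately show "card (A \<union> B \<union> C) = card A + 2 * card D" "card (D \<union> B \<union> C) = 3 * card D"
    using disjoint_AB disjoint_C finite_families card_B by (simp_all add: card_Un_disjoint Int_Un_distrib2)
qed

end

text \<open>
  The bound on \<open>card A + card Z\<close> is what a step to a position with parameter 0 needs, and \<open>card D\<close>
  feeds a step to one with nonzero parameter.  The summand 1 in the last bound yields strictness in
  the step between two equal nonzero parameters.
\<close>

lemma orbit_family_exists:
  fixes q :: "nat \<Rightarrow> 'k::zero"
  defines "E \<equiv> \<lambda>k. of_bool (\<exists>i\<ge>1. i < k \<and> q i = q (Suc i)) :: nat"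
  assumes "\<And>i. 1 \<le> i \<Longrightarrow> i < k \<Longrightarrow> q i = 0 \<or> q (Suc i) = 0 \<or> q i = q (Suc i)"
  shows "\<exists>A D Z. orbit_family q k A D Z \<and>
    card A \<ge> fib (k + 2) + E k \<and> card A + card Z \<ge> fib (k + 3) + E k \<and>
    (if k = 0 \<or> q k = 0 then card D \<ge> fib (k + 1) \<and> Z = A else 2 * card D \<ge> fib (k + 2) + 1)"
  using assms(2)
proof (induction k)
  case 0
  show ?case
    by (intro exI conjI, rule orbit_family_0) (simp_all add: E_def eval_nat_numeral)
next
  case (Suc k)
  then obtain A D Z where fam: "orbit_family q k A D Z"
    and a: "card A \<ge> fib (k + 2) + E k" and az: "card A + card Z \<ge> fib (k + 3) + E k"
    and d: "if k = 0 \<or> q k = 0 then card D \<ge> fib (k + 1) \<and> Z = A else 2 * card D \<ge> fib (k + 2) + 1"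
    by auto
  have f: "fib (k + 2) = fib (k + 1) + fib k" "fib (k + 3) = fib (k + 2) + fib (k + 1)"
    "fib (k + 4) = fib (k + 3) + fib (k + 2)"
    by (simp_all add: eval_nat_numeral)
  have f1: "fib (k + 1) \<ge> 1" "fib k \<le> fib (k + 1)"
    using fib_neq_0_nat[of "k + 1"] fib_mono[of k "k + 1"] by auto
  have f2: "fib k \<ge> 1" if "k \<noteq> 0"
    using fib_neq_0_nat[of k] that by auto
  \<comment> \<open>Passing to \<open>Suc k\<close> adds only the comparison of the parameters at
    \<open>k\<close> and \<open>Suc k\<close>.\<close>
  have E_le: "E (Suc k) \<le> E k + of_bool (k \<noteq> 0 \<and> q k = q (Suc k))"
    by (auto simp: E_def less_Suc_eq)
  have E1: "E k \<le> 1" "E (Suc k) \<le> 1" by (auto simp: E_def)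
  show ?case
  proof (cases "q (Suc k) = 0")
    case True
    let ?B = "(\<lambda>(S, x). (insert (Suc k) S, x)) ` Z"
    note st = orbit_family_zero_step[OF fam True]
    \<comment> \<open>Two adjacent zero parameters double \<open>A\<close>, because then
      \<open>Z = A\<close>; the surplus \<open>2 * fib (k + 2) - fib (k + 3) = fib k \<ge> 1\<close>
      gives strictness. Otherwise no new equality arises and the bound on
      \<open>card A + card Z\<close> suffices.\<close>
    have a': "card (A \<union> ?B) \<ge> fib (k + 3) + E (Suc k)"
    proof (cases "k \<noteq> 0 \<and> q k = 0")
      case True
      then have "Z = A" using d by simp
      then show ?thesis
        using st(2) a f f1 f2 True E1 by simp
    next
      case False
      then have "E (Suc k) \<le> E k" using E_le \<open>q (Suc k) = 0\<close> by auto
      then show ?thesis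
        using st(2) az by simp
    qed
    have "orbit_family q (Suc k) (A \<union> ?B) A (A \<union> ?B) \<and>
      card (A \<union> ?B) \<ge> fib (Suc k + 2) + E (Suc k) \<and>
      card (A \<union> ?B) + card (A \<union> ?B) \<ge> fib (Suc k + 3) + E (Suc k) \<and> card A \<ge> fib (Suc k + 1)"
      using st(1) a' a f f1 by (simp add: eval_nat_numeral)
    then show ?thesis
      using True by (intro exI[of _ "A \<union> ?B"] exI[of _ A]) simp
  next
    case False
    let ?B = "(\<lambda>(S, x). (S, swap_letters (Suc k) x)) ` D"
    show ?thesis
    proof (cases "k = 0 \<or> q k = 0")
      case True
      note st = orbit_family_first_step[OF fam False]
      \<comment> \<open>A block opens here, so the new position creates no equality. The bound for
        the new \<open>D\<close> follows from
        \<open>4 * fib (k + 1) \<ge> fib (k + 3) + 1\<close>.\<close>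
      have "E (Suc k) \<le> E k" using E_le True False by auto
      moreover have "card D \<ge> fib (k + 1)" "Z = A" using d True by auto
      ultimately have "orbit_family q (Suc k) (A \<union> ?B) (D \<union> ?B) Z \<and>
        card (A \<union> ?B) \<ge> fib (Suc k + 2) + E (Suc k) \<and>
        card (A \<union> ?B) + card Z \<ge> fib (Suc k + 3) + E (Suc k) \<and> 2 * card (D \<union> ?B) \<ge> fib (Suc k + 2) + 1"
        using st a f f1 by (simp add: eval_nat_numeral)
      then show ?thesis
        using False by (intro exI[of _ "A \<union> ?B"] exI[of _ "D \<union> ?B"] exI[of _ Z]) simp
    next
      case k: False
      let ?C = "(\<lambda>(S, x). (S, swap_letters k (swap_letters (Suc k) x))) ` D"
      have st: "orbit_family q (Suc k) (A \<union> ?B \<union> ?C) (D \<union> ?B \<union> ?C) Z"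
        "card (A \<union> ?B \<union> ?C) = card A + 2 * card D" "card (D \<union> ?B \<union> ?C) = 3 * card D"
        using orbit_family_next_step[OF fam False] k by auto
      \<comment> \<open>This many points are added to \<open>A\<close>; the extra 1 pays for
        \<open>E (Suc k) \<le> 1\<close>.\<close>
      have "2 * card D \<ge> fib (k + 2) + 1" using d k by auto
      then have "orbit_family q (Suc k) (A \<union> ?B \<union> ?C) (D \<union> ?B \<union> ?C) Z \<and>
        card (A \<union> ?B \<union> ?C) \<ge> fib (Suc k + 2) + E (Suc k) \<and>
        card (A \<union> ?B \<union> ?C) + card Z \<ge> fib (Suc k + 3) + E (Suc k) \<and>
        2 * card (D \<union> ?B \<union> ?C) \<ge> fib (Suc k + 2) + 1"
        using st a az f f1 E1 by (simp add: eval_nat_numeral)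
      then show ?thesis
        using False by (intro exI[of _ "A \<union> ?B \<union> ?C"] exI[of _ "D \<union> ?B \<union> ?C"] exI[of _ Z]) simp
    qed
  qed
qed

section \<open>The lower bound for the dimension\<close>

lemma hecke_dim_lower_bound:
  fixes q :: "nat \<Rightarrow> 'k::field"
  assumes "collapse_free {1..n} coxeter_A q"
  shows "hecke_dim {1..n} coxeter_A q
    \<ge> enat (fib (n + 2) + of_bool (\<exists>i\<ge>1. i < n \<and> q i = q (Suc i)))"
proof -
  obtain A D Z where fam: "orbit_family q n A D Z"
    and card: "card A \<ge> fib (n + 2) + of_bool (\<exists>i\<ge>1. i < n \<and> q i = q (Suc i))"
    using orbit_family_exists[of n q] collapse_free_adjacent[OF assms] by blast
  interpret hecke_action "word_op (block_mode q) q" "{1..n}" coxeter_A q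
    by (rule hecke_action_block_mode[OF assms])
  have "enat (card A) \<le> hecke_dim {1..n} coxeter_A q"
  proof (rule hecke_dim_ge)
    show "finite A" by (rule orbit_familyD(1)[OF fam])
    fix y assume y: "y \<in> A"
    obtain S x where "y = (S, x)" by force
    with y show "\<exists>p\<in>carrier (free_algebra {1..n}).
        act (word_op (block_mode q) q) p (start_vector n q) = (\<lambda>z. of_bool (z = y))"
      using point_in_orbit[OF assms orbit_familyD(4,7)[OF fam]] by simp
  qed
  then show ?thesis
    using card by (meson enat_ord_simps(1) order_trans)
qed

section \<open>Commutativity and the upper bound\<close>

lemma hecke_relation_quadratic:
  "s \<in> S \<Longrightarrow> (gen s - 1) * (gen s + scalar (q s)) \<in> hecke_ideal S m q"
  by (rule hecke_relations_in_ideal) (auto simp: hecke_relations_def)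

lemma hecke_relation_braid3:
  "s \<in> S \<Longrightarrow> t \<in> S \<Longrightarrow> m s t = 3 \<Longrightarrow>
    gen s * gen t * gen s - gen t * gen s * gen t \<in> hecke_ideal S m q"
  by (rule hecke_relations_in_ideal) (auto simp: hecke_relations_def)

lemma hecke_relation_braid2:
  "s \<in> S \<Longrightarrow> t \<in> S \<Longrightarrow> m s t = 2 \<Longrightarrow> gen s * gen t - gen t * gen s \<in> hecke_ideal S m q"
  by (rule hecke_relations_in_ideal) (auto simp: hecke_relations_def)

text \<open>Modulo the ideal, \<open>e = gen s\<close> is idempotent and \<open>g = gen t\<close> is
  invertible, since \<open>g * (g + c - 1)\<close> equals the nonzero scalar \<open>c\<close>. The
  braid relation yields an equation from which \<open>g\<close> can be cancelled on both
  sides.\<close>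

lemma absorb_generator:
  fixes q :: "'s \<Rightarrow> 'k::field"
  assumes s: "s \<in> S" and t: "t \<in> S" and m: "m s t = 3" and qs: "q s = 0" and qt: "q t \<noteq> 0"
  shows "gen s * gen t - gen s \<in> hecke_ideal S m q" "gen t * gen s - gen s \<in> hecke_ideal S m q"
proof -
  let ?I = "hecke_ideal S m q" and ?F = "free_algebra S :: ('s, 'k) nc_poly ring"
  define e g c d :: "('s, 'k) nc_poly"
    where "e = gen s" and "g = gen t" and "c = scalar (q t)" and "d = scalar (inverse (q t))"
  have carr: "e \<in> carrier ?F" "g \<in> carrier ?F" "c \<in> carrier ?F" "d \<in> carrier ?F"
    using s t by (auto simp: e_def g_def c_def d_def)
  have cd: "c * d = 1" "d * c = 1"
    using qt unfolding c_def d_def by (simp_all flip: scalar_simps(2,5))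
  have gc: "g * c = c * g"
    unfolding c_def by (rule scalar_commute[symmetric])
  define r1 r2 r3 where "r1 = (e - 1) * e" and "r2 = (g - 1) * (g + c)" and "r3 = e * g * e - g * e * g"
  have r: "r1 \<in> ?I" "r2 \<in> ?I" "r3 \<in> ?I"
    using hecke_relation_quadratic[OF s, of q m] hecke_relation_quadratic[OF t, of q m]
      hecke_relation_braid3[OF s t, of m q] m qs
    by (simp_all add: r1_def r2_def r3_def e_def g_def c_def scalar_simps)
  have lmult: "p * a \<in> ?I" and rmult: "a * p \<in> ?I" if "a \<in> ?I" "p \<in> carrier ?F" for a p
    using that by (auto intro: hecke_ideal_lmult hecke_ideal_rmult)
  have m1: "r1 * (g * e) \<in> ?I" "e * r3 \<in> ?I" "r3 * g \<in> ?I" "g * e * r2 \<in> ?I" "r2 * (e * g - e) \<in> ?I"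
    using carr by (simp_all only: lmult rmult r free_algebra_mult_closed free_algebra_minus_closed)
  \<comment> \<open>Modulo the ideal,
    \<open>geg = ege = e(ege) = e(geg) = (ege)g = gegg\<close>.\<close>
  have "g * e * g * g - g * e * g = r1 * (g * e) - e * r3 - r3 * g + r3"
    by (simp add: r1_def r3_def algebra_simps)
  then have a2: "g * e * g * g - g * e * g \<in> ?I"
    using r(3) m1 by (metis hecke_ideal_add hecke_ideal_diff)
  \<comment> \<open>Cancels \<open>g\<close> on the right of \<open>gegg = geg\<close>, leaving
    \<open>geg = ge\<close> once \<open>c\<close> is inverted.\<close>
  have "(g * e * g - g * e) * c = g * e * r2 - (g * e * g * g - g * e * g)"
    by (simp add: r2_def algebra_simps)
  then have "(g * e * g - g * e) * c \<in> ?I"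
    using m1(4) a2 by (metis hecke_ideal_diff)
  from hecke_ideal_rmult[OF this carr(4)] have a3: "g * e * g - g * e \<in> ?I"
    by (simp add: mult.assoc cd)
  \<comment> \<open>Cancels \<open>g\<close> on the left of \<open>geg = ge\<close>, with
    \<open>g + c - 1\<close> as inverse up to the factor \<open>c\<close>.\<close>
  have "c * (e * g - e) = (g + c - 1) * (g * e * g - g * e) - r2 * (e * g - e)"
    by (simp add: r2_def algebra_simps gc)
  moreover have "(g + c - 1) * (g * e * g - g * e) \<in> ?I"
    using carr by (intro lmult a3) auto
  ultimately have "c * (e * g - e) \<in> ?I"
    using m1(5) by (simp only: hecke_ideal_diff)
  from hecke_ideal_lmult[OF this carr(4)] have a4: "e * g - e \<in> ?I"
    by (simp add: mult.assoc[symmetric] cd)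
  \<comment> \<open>Modulo the ideal, \<open>ge = geg = ege = ee = e\<close>.\<close>
  have "g * e - e = (e * g - e) * e + r1 - (g * e * g - g * e) - r3"
    by (simp add: r1_def r3_def algebra_simps)
  moreover have "(e * g - e) * e + r1 - (g * e * g - g * e) - r3 \<in> ?I"
    by (intro hecke_ideal_add hecke_ideal_diff rmult r a3 a4 carr)
  ultimately have a5: "g * e - e \<in> ?I" by (simp only:)
  show "gen s * gen t - gen s \<in> ?I" "gen t * gen s - gen s \<in> ?I"
    using a4 a5 by (simp_all add: e_def g_def)
qed

text \<open>By collapse-freeness exactly one of the two parameters is 0, and the generator with
  parameter 0 absorbs the other in both orders.\<close>

lemma adjacent_product:
  fixes q :: "nat \<Rightarrow> 'k::field"
  assumes cf: "collapse_free {1..n} coxeter_A q"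
    and k: "1 \<le> k" "k < n" and neq: "q k \<noteq> q (Suc k)"
  shows "\<exists>x\<in>{gen k, gen (Suc k)}. gen k * gen (Suc k) - x \<in> hecke_ideal {1..n} coxeter_A q
    \<and> gen (Suc k) * gen k - x \<in> hecke_ideal {1..n} coxeter_A q"
proof -
  have "q k = 0 \<and> q (Suc k) \<noteq> 0 \<or> q (Suc k) = 0 \<and> q k \<noteq> 0"
    using collapse_free_adjacent[OF cf k] neq by auto
  then show ?thesis
    using absorb_generator[of k "{1..n}" "Suc k" coxeter_A q]
      absorb_generator[of "Suc k" "{1..n}" k coxeter_A q] k
    by (auto simp: coxeter_A_def)
qed

lemma generators_commute:
  fixes q :: "nat \<Rightarrow> 'k::field"
  assumes cf: "collapse_free {1..n} coxeter_A q"
    and neq: "\<And>k. 1 \<le> k \<Longrightarrow> k < n \<Longrightarrow> q k \<noteq> q (Suc k)"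
    and ij: "i \<in> {1..n}" "j \<in> {1..n}"
  shows "gen i * gen j - gen j * gen i \<in> hecke_ideal {1..n} coxeter_A q"
proof -
  let ?I = "hecke_ideal {1..n} coxeter_A q"
  have adj: "gen k * gen (Suc k) - gen (Suc k) * gen k \<in> ?I" if k: "1 \<le> k" "k < n" for k
  proof -
    from adjacent_product[OF cf k neq[OF k]] obtain x
      where "gen k * gen (Suc k) - x \<in> ?I" "gen (Suc k) * gen k - x \<in> ?I" by blast
    from hecke_ideal_diff[OF this] show ?thesis by simp
  qed
  consider "i = j" | "j = Suc i" | "i = Suc j" | "coxeter_A i j = 2"
    unfolding coxeter_A_def Suc_eq_plus1 by presburger
  then show ?thesis
  proof cases
    case 1
    \<comment> \<open>The commutator is 0, which lies in the ideal as a relation minus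
      itself.\<close>
    then show ?thesis using hecke_ideal_diff[OF hecke_relation_quadratic[OF ij(1)] hecke_relation_quadratic[OF ij(1)]] by simp
  next
    case 2
    then show ?thesis using adj[of i] ij by auto
  next
    case 3
    then show ?thesis using hecke_ideal_uminus[OF adj[of j]] ij by auto
  next
    case 4
    then show ?thesis using hecke_relation_braid2[OF ij] by blast
  qed
qed

text \<open>The commutator with \<open>p\<close> is additive and satisfies the Leibniz rule, so it
  maps everything into the ideal once it does so on generators.\<close>

lemma commute_modulo_ideal:
  assumes p: "p \<in> carrier (free_algebra S)" and r: "r \<in> carrier (free_algebra S)"
    and gens: "\<And>s. s \<in> S \<Longrightarrow> p * gen s - gen s * p \<in> hecke_ideal S m q"
  shows "p * r - r * p \<in> hecke_ideal S m q"
  using r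
proof (induction r rule: free_algebra_induct)
  case (scalar c)
  have "p * scalar c - scalar c * p = 0"
    using scalar_commute[of c p] by simp
  then show ?case
    using additive_subgroup.zero_closed[OF ideal.axioms(1)[OF ideal_hecke_ideal]] by force
next
  case (gen s)
  then show ?case by (rule gens)
next
  case (add a b)
  have "p * (a + b) - (a + b) * p = (p * a - a * p) + (p * b - b * p)"
    by (simp add: algebra_simps)
  then show ?case using add by (simp add: hecke_ideal_add)
next
  case (mult a b)
  have eq: "p * (a * b) - a * b * p = (p * a - a * p) * b + a * (p * b - b * p)"
    by (simp add: algebra_simps)
  show ?case
    unfolding eq using mult by (intro hecke_ideal_add hecke_ideal_rmult hecke_ideal_lmult)
qed

lemma cring_hecke_algebraI:
  assumes "\<And>s t. s \<in> S \<Longrightarrow> t \<in> S \<Longrightarrow> gen s * gen t - gen t * gen s \<in> hecke_ideal S m q"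
  shows "cring (hecke_algebra S m q)"
proof -
  interpret H: ring "hecke_algebra S m q" by (rule ring_hecke_algebra)
  have comm: "p * r - r * p \<in> hecke_ideal S m q"
    if p: "p \<in> carrier (free_algebra S)" and r: "r \<in> carrier (free_algebra S)" for p r
  proof (rule commute_modulo_ideal[OF p r])
    fix s assume s: "s \<in> S"
    \<comment> \<open>The criterion is applied twice: here for a generator against \<open>p\<close>,
      and outside for \<open>p\<close> against \<open>r\<close>.\<close>
    have "gen s * p - p * gen s \<in> hecke_ideal S m q"
      using s assms by (intro commute_modulo_ideal[OF _ p]) auto
    from hecke_ideal_uminus[OF this] show "p * gen s - gen s * p \<in> hecke_ideal S m q" by simp
  qed
  show ?thesis
  proof (intro cring.intro ring_hecke_algebra comm_monoid.intro H.monoid_axioms comm_monoid_axioms.intro)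
    fix x y assume "x \<in> carrier (hecke_algebra S m q)" "y \<in> carrier (hecke_algebra S m q)"
    then obtain p r where pr: "p \<in> carrier (free_algebra S)" "r \<in> carrier (free_algebra S)"
      and "x = hecke_class S m q p" "y = hecke_class S m q r"
      by (auto simp: carrier_hecke_algebra)
    then show "x \<otimes>\<^bsub>hecke_algebra S m q\<^esub> y = y \<otimes>\<^bsub>hecke_algebra S m q\<^esub> x"
      using comm[OF pr] by (simp add: hecke_class_mult hecke_class_eq_iff)
  qed
qed

lemma cring_hecke_algebra_iff:
  fixes q :: "nat \<Rightarrow> 'k::field"
  assumes cf: "collapse_free {1..n} coxeter_A q"
  shows "cring (hecke_algebra {1..n} coxeter_A q) \<longleftrightarrow> \<not> (\<exists>k\<ge>1. k < n \<and> q k = q (Suc k))"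
proof (intro iffI notI)
  assume cring: "cring (hecke_algebra {1..n} coxeter_A q)" and "\<exists>k\<ge>1. k < n \<and> q k = q (Suc k)"
  then obtain k where k: "1 \<le> k" "k < n" "q k = q (Suc k)" by blast
  let ?c = "hecke_class {1..n} coxeter_A q"
  have carr: "(gen k :: (nat, 'k) nc_poly) \<in> carrier (free_algebra {1..n})"
    "(gen (Suc k) :: (nat, 'k) nc_poly) \<in> carrier (free_algebra {1..n})"
    using k by auto
  have "?c (gen k) \<otimes>\<^bsub>hecke_algebra {1..n} coxeter_A q\<^esub> ?c (gen (Suc k))
      = ?c (gen (Suc k)) \<otimes>\<^bsub>hecke_algebra {1..n} coxeter_A q\<^esub> ?c (gen k)"
    using carr by (intro comm_monoid.m_comm[OF cring.axioms(2)[OF cring]]) (auto simp: carrier_hecke_algebra)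
  then show False
    using noncommuting_generators[OF cf k] carr by (simp add: hecke_class_mult hecke_class_eq_iff)
next
  assume "\<not> (\<exists>k\<ge>1. k < n \<and> q k = q (Suc k))"
  then show "cring (hecke_algebra {1..n} coxeter_A q)"
    using generators_commute[OF cf] by (intro cring_hecke_algebraI) blast
qed

section \<open>A spanning set of products of pairwise nonadjacent generators\<close>

inductive span_modulo ::
    "'s set \<Rightarrow> ('s \<Rightarrow> 's \<Rightarrow> nat) \<Rightarrow> ('s \<Rightarrow> 'k::field) \<Rightarrow> ('s, 'k) nc_poly set \<Rightarrow> ('s, 'k) nc_poly \<Rightarrow> bool"
  for S m q B
  where ideal: "a \<in> hecke_ideal S m q \<Longrightarrow> span_modulo S m q B a"
  | base: "b \<in> B \<Longrightarrow> span_modulo S m q B (scalar c * b)"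
  | add: "span_modulo S m q B a \<Longrightarrow> span_modulo S m q B b \<Longrightarrow> span_modulo S m q B (a + b)"

lemma span_modulo_base: "b \<in> B \<Longrightarrow> span_modulo S m q B b"
  using span_modulo.base[of b B S m q 1] by (simp add: scalar_simps)

lemma span_modulo_mono: "span_modulo S m q B a \<Longrightarrow> B \<subseteq> B' \<Longrightarrow> span_modulo S m q B' a"
  by (induction rule: span_modulo.induct) (auto intro: span_modulo.intros)

lemma span_modulo_scalar: "span_modulo S m q B a \<Longrightarrow> span_modulo S m q B (scalar d * a)"
proof (induction rule: span_modulo.induct)
  case (ideal a)
  then show ?case by (auto intro!: span_modulo.ideal hecke_ideal_lmult)
next
  case (base b c)
  then show ?case
    using span_modulo.base[of b B S m q "d * c"] by (simp add: scalar_simps mult.assoc)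
next
  case (add a b)
  then show ?case by (simp add: distrib_left span_modulo.add)
qed

lemma span_modulo_cong:
  assumes "span_modulo S m q B a" "b - a \<in> hecke_ideal S m q"
  shows "span_modulo S m q B b"
  using span_modulo.add[OF assms(1) span_modulo.ideal[OF assms(2)]] by simp

lemma span_modulo_rmult:
  assumes "span_modulo S m q B a" "g \<in> carrier (free_algebra S)"
    and "\<And>b. b \<in> B \<Longrightarrow> span_modulo S m q B' (b * g)"
  shows "span_modulo S m q B' (a * g)"
  using assms(1)
proof induction
  case (ideal a)
  then show ?case using assms(2) by (auto intro!: span_modulo.ideal hecke_ideal_rmult)
next
  case (base b c)
  then show ?case using assms(3) by (simp add: mult.assoc span_modulo_scalar)
next
  case (add a b)
  then show ?case by (simp add: distrib_right span_modulo.add)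
qed

text \<open>Transfers spanning from representatives to the quotient. Membership in the carrier is
  proved along, as adding classes requires it.\<close>

lemma span_modulo_Span:
  assumes "span_modulo S m q (set bs) a" and bs: "set bs \<subseteq> carrier (free_algebra S)"
  shows "a \<in> carrier (free_algebra S) \<and> hecke_class S m q a
    \<in> ring.Span (hecke_algebra S m q) (hecke_scalars S m q) (map (hecke_class S m q) bs)"
proof -
  interpret H: ring "hecke_algebra S m q" by (rule ring_hecke_algebra)
  note K = subfield_hecke_scalars[of S m q]
  have Us: "set (map (hecke_class S m q) bs) \<subseteq> carrier (hecke_algebra S m q)"
    using bs by (auto simp: carrier_hecke_algebra)
  note Span = H.Span_subgroup_props[OF K Us]
  from assms(1) show ?thesis
  proof induction
    case (ideal a)
    then have "a \<in> carrier (free_algebra S)" by (rule hecke_ideal_closed)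
    moreover from this have "hecke_class S m q a = \<zero>\<^bsub>hecke_algebra S m q\<^esub>"
      using ideal by (simp add: hecke_class_zero hecke_class_eq_iff)
    ultimately show ?case using Span(2) by simp
  next
    case (base b c)
    then have b: "b \<in> carrier (free_algebra S)" using bs by blast
    have "hecke_class S m q b \<in> H.Span (hecke_scalars S m q) (map (hecke_class S m q) bs)"
      using base H.Span_base_incl[OF K Us] by auto
    moreover have "hecke_class S m q (scalar c) \<in> hecke_scalars S m q"
      by (simp add: hecke_scalars_eq)
    ultimately have "hecke_class S m q (scalar c) \<otimes>\<^bsub>hecke_algebra S m q\<^esub> hecke_class S m q b
        \<in> H.Span (hecke_scalars S m q) (map (hecke_class S m q) bs)"
      using H.Span_smult_closed[OF K Us] by blast
    then show ?case using b by (auto simp: hecke_class_mult)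
  next
    case (add a b)
    then show ?case using Span(3) by (metis hecke_class_add free_algebra_add_closed)
  qed
qed

text \<open>The name refers to independent sets of the path with vertices \<open>1\<close> to
  \<open>k\<close>: subsets without two consecutive numbers, split by whether they contain the last
  vertex. Linear independence is not meant.\<close>

fun independent_products :: "nat \<Rightarrow> (nat, 'k::field) nc_poly list"
  where "independent_products 0 = [1]"
  | "independent_products (Suc 0) = [1, gen 1]"
  | "independent_products (Suc (Suc k)) =
      independent_products (Suc k) @ map (\<lambda>b. b * gen (Suc (Suc k))) (independent_products k)"

lemma length_independent_products: "length (independent_products k) = fib (k + 2)"
  by (induction k rule: independent_products.induct) (simp_all add: eval_nat_numeral)

lemma independent_products_closed:
  "k \<le> n \<Longrightarrow> set (independent_products k) \<subseteq> carrier (free_algebra {1..n})"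
  by (induction k rule: independent_products.induct) auto

lemma independent_products_mono: "set (independent_products k) \<subseteq> set (independent_products (Suc k))"
  by (cases k) auto

lemma one_independent_products: "1 \<in> set (independent_products k)"
  by (induction k rule: independent_products.induct) auto

lemma independent_products_Suc:
  assumes "b \<in> set (independent_products (Suc k))"
  shows "b \<in> set (independent_products k) \<or> (\<exists>b'\<in>set (independent_products k). b = b' * gen (Suc k))"
proof (cases k)
  case 0
  then show ?thesis using assms by auto
next
  case (Suc l)
  then show ?thesis using assms independent_products_mono[of l] by auto
qed

lemma span_modulo_square:
  assumes b: "b \<in> carrier (free_algebra S)" "s \<in> S"
    and span: "span_modulo S m q B b" "span_modulo S m q B (b * gen s)"
  shows "span_modulo S m q B (b * gen s * gen s)"
proof (rule span_modulo_cong)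
  show "span_modulo S m q B (scalar (1 - q s) * (b * gen s) + scalar (q s) * b)"
    using span by (intro span_modulo.add span_modulo_scalar)
  have "b * gen s * gen s - (scalar (1 - q s) * (b * gen s) + scalar (q s) * b)
      = b * ((gen s - 1) * (gen s + scalar (q s)))"
    using scalar_commute[of "q s" "b * gen s"] scalar_commute[of "q s" b]
    by (simp add: scalar_simps algebra_simps)
  then show "b * gen s * gen s - (scalar (1 - q s) * (b * gen s) + scalar (q s) * b) \<in> hecke_ideal S m q"
    using hecke_ideal_lmult[OF hecke_relation_quadratic[OF b(2)] b(1)] by metis
qed

text \<open>A new factor either extends a product, meets its own generator and is reduced by the
  quadratic relation, or meets an adjacent one and is reduced by absorption.\<close>

lemma independent_products_rmult:
  fixes q :: "nat \<Rightarrow> 'k::field"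
  assumes cf: "collapse_free {1..n} coxeter_A q"
    and neq: "\<And>k. 1 \<le> k \<Longrightarrow> k < n \<Longrightarrow> q k \<noteq> q (Suc k)"
    and "k \<le> n" "b \<in> set (independent_products k)" "i \<in> {1..k}"
  shows "span_modulo {1..n} coxeter_A q (set (independent_products k)) (b * gen i)"
  using assms(3-)
proof (induction k arbitrary: b i rule: independent_products.induct)
  case 1
  then show ?case by simp
next
  case 2
  let ?sp = "span_modulo {1..n} coxeter_A q (set (independent_products (Suc 0)))"
  have "?sp 1" "?sp (1 * gen 1)"
    by (rule span_modulo_base; simp)+
  moreover from this have "?sp (1 * gen 1 * gen 1)"
    using 2 by (intro span_modulo_square) auto
  moreover have "i = 1" using 2 by simp
  ultimately show ?case
    using 2 by auto
next
  case (3 k)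
  let ?I = "hecke_ideal {1..n} coxeter_A q"
  let ?B = "\<lambda>k. set (independent_products k) :: (nat, 'k) nc_poly set"
  let ?sp = "\<lambda>k. span_modulo {1..n} coxeter_A q (?B k)"
  let ?g = "gen (Suc (Suc k)) :: (nat, 'k) nc_poly" and ?h = "gen (Suc k) :: (nat, 'k) nc_poly"
  have mono: "?B k \<subseteq> ?B (Suc (Suc k))" "?B (Suc k) \<subseteq> ?B (Suc (Suc k))"
    using independent_products_mono[of k] by auto
  have closed: "?B k \<subseteq> carrier (free_algebra {1..n})"
    using 3 by (intro independent_products_closed) simp
  have g: "?sp (Suc (Suc k)) (b * ?g)" if "b \<in> ?B k" for b
    using that by (intro span_modulo_base) simp
  have k: "1 \<le> Suc k" "Suc k < n" using "3.prems"(1) by simp_all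
  obtain x where x: "x \<in> {?h, ?g}" and hg: "?h * ?g - x \<in> ?I" and gh: "?g * ?h - x \<in> ?I"
    using adjacent_product[OF cf k neq[OF k]] by blast
  have h: "?sp (Suc (Suc k)) (b * ?h)" if "b \<in> ?B k" for b
  proof -
    have "b \<in> ?B (Suc k)" using that independent_products_mono by blast
    then have "?sp (Suc k) (b * ?h)" using 3 by (intro "3.IH"(1)) auto
    then show ?thesis by (rule span_modulo_mono[OF _ mono(2)])
  qed
  \<comment> \<open>Whichever of the two adjacent generators absorbs the other, the result stays in
    the span.\<close>
  have xx: "?sp (Suc (Suc k)) (b * x)" if "b \<in> ?B k" for b
    using x g[OF that] h[OF that] by blast
  have adj: "?sp (Suc (Suc k)) (b * ?h * ?g)" "?sp (Suc (Suc k)) (b * ?g * ?h)" if b: "b \<in> ?B k" for b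
  proof -
    have "b * ?h * ?g - b * x = b * (?h * ?g - x)" "b * ?g * ?h - b * x = b * (?g * ?h - x)"
      by (simp_all add: algebra_simps)
    moreover have "b * (?h * ?g - x) \<in> ?I" "b * (?g * ?h - x) \<in> ?I"
      using b closed by (blast intro: hecke_ideal_lmult hg gh)+
    ultimately have "b * ?h * ?g - b * x \<in> ?I" "b * ?g * ?h - b * x \<in> ?I"
      by (simp_all only:)
    then show "?sp (Suc (Suc k)) (b * ?h * ?g)" "?sp (Suc (Suc k)) (b * ?g * ?h)"
      using span_modulo_cong[OF xx[OF b]] by blast+
  qed
  have "b \<in> ?B (Suc k) \<or> (\<exists>b'\<in>?B k. b = b' * ?g)"
    using "3.prems"(2) by auto
  then show ?case
  proof
    assume b: "b \<in> ?B (Suc k)"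
    show ?thesis
    proof (cases "i = Suc (Suc k)")
      case True
      then show ?thesis
        \<comment> \<open>If \<open>b\<close> does not end in \<open>?h\<close>, then
          \<open>b * ?g\<close> is a listed product; otherwise \<open>?h * ?g\<close> reduces to
          \<open>x\<close>.\<close>
        using independent_products_Suc[OF b] g adj(1) by blast
    next
      case False
      then have "?sp (Suc k) (b * gen i)"
        using b 3 by (intro "3.IH"(1)) auto
      then show ?thesis by (rule span_modulo_mono[OF _ mono(2)])
    qed
  next
    assume "\<exists>b'\<in>?B k. b = b' * ?g"
    then obtain b' where b': "b' \<in> ?B k" and b: "b = b' * ?g" by blast
    have carr: "b' \<in> carrier (free_algebra {1..n})" using b' closed by blast
    consider "i = Suc (Suc k)" | "i = Suc k" | "i \<le> k" using 3 by fastforce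
    then show ?thesis
    proof cases
      case 1
      have "?sp (Suc (Suc k)) b'" using b' mono by (intro span_modulo_base) blast
      then show ?thesis
        unfolding b 1 using g[OF b'] carr "3.prems"(1) by (intro span_modulo_square) simp_all
    next
      case 2
      then show ?thesis using adj(2)[OF b'] unfolding b by (simp only:)
    next
      case i: 3
      \<comment> \<open>The factor \<open>gen i\<close> is moved past \<open>?g\<close>, reduced
        among the first \<open>k\<close> generators, and \<open>?g\<close> is then appended to the
        result.\<close>
      have "?sp k (b' * gen i)" using b' i "3.prems" by (intro "3.IH"(2)) auto
      then have "?sp (Suc (Suc k)) (b' * gen i * ?g)"
        by (rule span_modulo_rmult) (use "3.prems"(1) g in simp_all)
      moreover have "b' * ?g * gen i - b' * gen i * ?g \<in> ?I"
      proof -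
        have "b' * ?g * gen i - b' * gen i * ?g = b' * (?g * gen i - gen i * ?g)"
          by (simp add: algebra_simps)
        moreover have "?g * gen i - gen i * ?g \<in> ?I"
          using "3.prems" i by (intro generators_commute[OF cf neq]) auto
        ultimately show ?thesis
          using hecke_ideal_lmult[OF _ carr] by (simp only:)
      qed
      ultimately show ?thesis
        unfolding b by (rule span_modulo_cong)
    qed
  qed
qed

text \<open>The span of the products contains 1 and is stable under right multiplication by the
  whole free algebra, so it contains the whole free algebra.\<close>

lemma hecke_dim_upper_bound:
  fixes q :: "nat \<Rightarrow> 'k::field"
  assumes cf: "collapse_free {1..n} coxeter_A q"
    and neq: "\<And>k. 1 \<le> k \<Longrightarrow> k < n \<Longrightarrow> q k \<noteq> q (Suc k)"
  shows "hecke_dim {1..n} coxeter_A q \<le> enat (fib (n + 2))"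
proof -
  let ?bs = "independent_products n :: (nat, 'k) nc_poly list" and ?c = "hecke_class {1..n} coxeter_A q"
  let ?sp = "span_modulo {1..n} coxeter_A q (set ?bs)"
  have closed: "set ?bs \<subseteq> carrier (free_algebra {1..n})"
    by (rule independent_products_closed) simp
  have rmult: "\<forall>a. ?sp a \<longrightarrow> ?sp (a * p)" if "p \<in> carrier (free_algebra {1..n})" for p
    using that
  proof (induction p rule: free_algebra_induct)
    case (scalar c)
    show ?case
    proof (intro allI impI)
      fix a assume "?sp a"
      then have "?sp (scalar c * a)" by (rule span_modulo_scalar)
      then show "?sp (a * scalar c)" by (simp only: scalar_commute[of c a])
    qed
  next
    case (gen s)
    then have "gen s \<in> carrier (free_algebra {1..n})" by blast
    then show ?case
      using span_modulo_rmult independent_products_rmult[OF cf neq le_refl _ gen] by blast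
  next
    case (add a b)
    then show ?case by (simp add: distrib_left span_modulo.add)
  next
    case (mult a b)
    from mult(3,4) show ?case
      unfolding mult.assoc[symmetric] by blast
  qed
  have "?sp p" if "p \<in> carrier (free_algebra {1..n})" for p
  proof -
    have "?sp (1 * p)"
      using rmult[OF that] span_modulo_base[OF one_independent_products] by blast
    then show ?thesis by (simp only: mult_1)
  qed
  then have "carrier (hecke_algebra {1..n} coxeter_A q)
      \<subseteq> ring.Span (hecke_algebra {1..n} coxeter_A q) (hecke_scalars {1..n} coxeter_A q) (map ?c ?bs)"
    using span_modulo_Span[OF _ closed] by (auto simp: carrier_hecke_algebra)
  then have "hecke_dim {1..n} coxeter_A q \<le> enat (length (map ?c ?bs))"
    using closed by (intro hecke_dim_le) (auto simp: carrier_hecke_algebra)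
  then show ?thesis by (simp add: length_independent_products)
qed

theorem theorem5p4:
  fixes n :: nat and q :: "nat \<Rightarrow> 'k::field"
  assumes "n \<ge> 1"
    and "collapse_free {1..n} coxeter_A q"
  shows "hecke_dim {1..n} coxeter_A q \<ge> enat (fib (n + 2))
    \<and> (hecke_dim {1..n} coxeter_A q = enat (fib (n + 2))
         \<longleftrightarrow> cring (hecke_algebra {1..n} coxeter_A q))"
\<comment> \<open>If two adjacent parameters agree, both sides of the equivalence are false;
  otherwise both are true.\<close>
proof (cases "\<exists>k\<ge>1. k < n \<and> q k = q (Suc k)")
  case True
  then have "enat (fib (n + 2) + 1) \<le> hecke_dim {1..n} coxeter_A q"
    using hecke_dim_lower_bound[OF assms(2)] by simp
  then have "enat (fib (n + 2)) < hecke_dim {1..n} coxeter_A q"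
    by (rule less_le_trans[rotated]) simp
  then show ?thesis
    using True cring_hecke_algebra_iff[OF assms(2)] by auto
next
  case False
  then have "enat (fib (n + 2)) \<le> hecke_dim {1..n} coxeter_A q"
    using hecke_dim_lower_bound[OF assms(2)] False by (simp only: of_bool_def if_False add_0_right)
  moreover have "hecke_dim {1..n} coxeter_A q \<le> enat (fib (n + 2))"
    using False by (intro hecke_dim_upper_bound[OF assms(2)]) auto
  ultimately show ?thesis
    using False cring_hecke_algebra_iff[OF assms(2)] by auto
qed


end
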